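(* Let $Y_{n+1}=MY_n+G\xi_{n+1}$ be a Gaussian autoregressive process on $\mathbb R^N$, with transition kernel $Q$, where $M\in\mathbb R^{N\times N}$ satisfies $\rho(M)<1$, $G\in\mathbb R^{N\times N'}$, the $\xi_n$ are i.i.d. standard Gaussian vectors in $\mathbb R^{N'}$, and the covariance $\Sigma_{n_0}$ of the $n_0$-step transition law is nonsingular for some $n_0\ge1$ (this holds in particular when $GG^\top\succ0$, with $n_0=1$). Then the chain has a unique invariant law $\pi$, which is a centered Gaussian. Moreover, $$\limsup_{n\to\infty}\|\delta_zQ^n-\pi\|_{\mathrm{TV}}^{1/n}\le\rho(M)\qquad\text{for every initial state }z,$$ and the limit exists and equals $\rho(M)$ for a suitable $z$. Finally, there are initial states $z,\widetilde z$ such that $$\lim_{n\to\infty}\|\delta_zQ^n-\delta_{\widetilde z}Q^n\|_{\mathrm{TV}}^{1/n}=\rho(M).$$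
   Context: $\rho(M)$ is the spectral radius of $M$; $\|\nu-\widetilde\nu\|_{\mathrm{TV}}=\sup_A|\nu(A)-\widetilde\nu(A)|$ over Borel sets $A$; $\delta_z$ is the Dirac mass at $z$; an invariant law is an invariant probability measure. The covariance of the $n$-step transition law is $\Sigma_n=\sum_{j=0}^{n-1}M^jGG^\top(M^\top)^j$. *)

theory Defs
  imports "HOL-Probability.Probability"
begin

(* On the vector type, "*" and "^" act componentwise, so matrix powers are
   spelled out via the matrix product. *)
definition matpow :: "real^'n^'n \<Rightarrow> nat \<Rightarrow> real^'n^'n" where
  "matpow M k = ((\<lambda>A. M ** A) ^^ k) (mat 1)"

(* The eigenvalues are the complex ones: M is regarded as a complex matrix. *)
definition spectrum :: "real^'n^'n \<Rightarrow> complex set" where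
  "spectrum M = {l. \<exists>v. v \<noteq> 0 \<and> map_matrix complex_of_real M *v v = l *s v}"

definition spectral_radius :: "real^'n^'n \<Rightarrow> real" where
  "spectral_radius M = Max (cmod ` spectrum M)"

definition std_gaussian :: "(real^'k) measure" where
  "std_gaussian = density lborel (\<lambda>x. ennreal (\<Prod>i\<in>UNIV. std_normal_density (x $ i)))"

(* Gaussian in the sense that every linear functional is normally distributed;
   normal_density is only meaningful for positive s, so variance 0
   (the Dirac mass at 0) is listed separately. *)
definition centered_gaussian :: "(real^'n) measure \<Rightarrow> bool" where
  "centered_gaussian \<mu> \<longleftrightarrow> prob_space \<mu> \<and> sets \<mu> = sets borel \<and>
     (\<forall>u. distr \<mu> borel (\<lambda>x. u \<bullet> x) = return borel 0 \<or>
          (\<exists>s>0. distr \<mu> borel (\<lambda>x. u \<bullet> x) = density lborel (\<lambda>t. ennreal (normal_density 0 s t))))"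

(* The transition kernel of Y(n+1) = M Y(n) + G \<xi>(n+1): the kernel at y
   is the law of M y + G \<xi> with \<xi> standard Gaussian. *)
definition ar_kernel :: "real^'n^'n \<Rightarrow> real^'k^'n \<Rightarrow> real^'n \<Rightarrow> (real^'n) measure" where
  "ar_kernel M G y = distr std_gaussian borel (\<lambda>x. M *v y + G *v x)"

(* The measure \<mu> Q^n. *)
definition kernel_iter :: "'a measure \<Rightarrow> ('a \<Rightarrow> 'a measure) \<Rightarrow> nat \<Rightarrow> 'a measure" where
  "kernel_iter \<mu> Q n = ((\<lambda>\<nu>. \<nu> \<bind> Q) ^^ n) \<mu>"

definition invariant_law :: "('a::topological_space \<Rightarrow> 'a measure) \<Rightarrow> 'a measure \<Rightarrow> bool" where
  "invariant_law Q \<mu> \<longleftrightarrow> prob_space \<mu> \<and> sets \<mu> = sets borel \<and> \<mu> \<bind> Q = \<mu>"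

definition ar_cov :: "real^'n^'n \<Rightarrow> real^'k^'n \<Rightarrow> nat \<Rightarrow> real^'n^'n" where
  "ar_cov M G n = (\<Sum>j<n. matpow M j ** G ** transpose G ** matpow (transpose M) j)"

definition tv_dist :: "'a::topological_space measure \<Rightarrow> 'a measure \<Rightarrow> real" where
  "tv_dist \<mu> \<nu> = (SUP A\<in>sets borel. \<bar>measure \<mu> A - measure \<nu> A\<bar>)"

end

theory Submission
  imports Defs "HOL-Computational_Algebra.Fundamental_Theorem_Algebra"
begin

text \<open>
  Write W(n) for the law of the chain after n steps from the origin, and P(z, n) for its law after
  n steps from z. The recursion is affine, so P(z, n) is W(n) translated by M^n z
  (kernel_iter_return_shift). Everything therefore depends on two questions: how well total variation
  sees a translation of W(n), and how fast M^n z decays.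

  Upper bound. Translating a standard Gaussian vector by g moves it by at most 3/2 |g| in total
  variation; this is read off from the Cameron-Martin density (tv_dist_gaussian_shift). Nonsingularity
  of the n0-step covariance means that every displacement h of the state is produced by
  displacing the last n0 noise vectors by amounts of size O(|h|) (reachable_with_bounded_controls).
  Hence P(z, n) and P(y, n) are at distance at most K |M^n (z - y)| as soon as n \<ge> n0
  (tv_dist_starting_points).

  Growth of powers. For every r above the spectral radius, |M^n x| \<le> C r^n |x| (matpow_growth).
  A polynomial annihilating M splits over the complex numbers, so every vector is killed by a product
  of factors A - l, and the bound follows by induction on the number of factors. In the other
  direction an eigenvector for an eigenvalue of maximal modulus yields a real z with
  |M^n z| \<ge> k \<rho>^n (spectral_radius_growth_attained).

  The invariant law. W(n + 1) is the mixture of the laws P(y, n) with y drawn from W(1), so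
  consecutive laws W(n), W(n + 1) are within O(r^n) of each other. Thus W(n) is a Cauchy sequence in
  total variation and converges to a probability measure \<pi> (tv_dist_complete) at the rate r^n, for
  each admissible r. Since Q does not increase total variation, \<pi> is invariant; since any
  invariant law is a mixture of the laws P(z, n), all of which tend to \<pi>, it is the only one.

  Gaussianity. The integral of cos(u \<bullet> x + \<theta>) against W(n) is exp(-q/2) cos \<theta> with
  q the variance of u \<bullet> x (cos_transform_kernel_iter). This passes to the limit \<pi> and
  determines the characteristic function of each linear functional.

  Lower bound. The function sin(u \<bullet> x) has mean 0 under \<pi> and under W(n), and mean
  exp(-q/2) sin(u \<bullet> M^n z) under P(z, n). For u the unit vector in the direction of M^n z this
  shows that the distance from P(z, n) to either law is at least c |M^n z| once |M^n z| \<le> 1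
  (tv_dist_lower_bound). With the z above, the distance eventually lies between c k \<rho>^n and C r^n for every
  r > \<rho>, and taking n-th roots gives the limit \<rho>.
\<close>

section \<open>Powers of a matrix and the spectral radius\<close>

text \<open>
  Indexing by natural numbers allows repetitions among the vectors; a repetition is itself a
  relation, and otherwise more than DIM vectors are dependent.
\<close>

lemma exists_nontrivial_combination:
  fixes f :: "nat \<Rightarrow> 'a::euclidean_space"
  shows "\<exists>c n. (\<exists>i\<le>n. c i \<noteq> 0) \<and> (\<Sum>i\<le>n. c i *\<^sub>R f i) = 0"
proof (cases "inj f")
  case False
  then obtain i j where ij: "i < j" "f i = f j"
    by (metis inj_def linorder_less_linear)
  define c :: "nat \<Rightarrow> real" where "c = (\<lambda>k. if k = i then 1 else if k = j then -1 else 0)"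
  have "(\<Sum>k\<le>j. c k *\<^sub>R f k) = (\<Sum>k\<in>{i,j}. c k *\<^sub>R f k)"
    using ij by (intro sum.mono_neutral_right) (auto simp: c_def)
  also have "\<dots> = 0" using ij by (simp add: c_def)
  finally show ?thesis using ij by (intro exI[of _ c] exI[of _ j]) (auto simp: c_def intro!: exI[of _ j])
next
  case True
  define n where "n = DIM('a)"
  have "dependent (f ` {..n})"
    using True by (intro dependent_biggerset) (auto simp: n_def card_image inj_on_subset[OF True])
  then obtain u v where u: "v \<in> f ` {..n}" "u v \<noteq> 0" "(\<Sum>v\<in>f ` {..n}. u v *\<^sub>R v) = 0"
    by (auto simp: dependent_finite)
  have "(\<Sum>i\<le>n. u (f i) *\<^sub>R f i) = 0"
    using u(3) by (subst (asm) sum.reindex) (auto simp: inj_on_subset[OF True])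
  then show ?thesis using u by (intro exI[of _ "u \<circ> f"] exI[of _ n]) auto
qed

lemma norm_complex_scalar_mult: "norm (c *s (v :: complex^'n)) = cmod c * norm v"
  by (simp add: norm_vec_def norm_mult L2_set_right_distrib)

abbreviation mv_iter :: "complex^'n^'n \<Rightarrow> nat \<Rightarrow> complex^'n \<Rightarrow> complex^'n" where
  "mv_iter A i \<equiv> ((*v) A) ^^ i"

lemma mv_iter_diff: "mv_iter A i (v - w) = mv_iter A i v - mv_iter A i w"
  by (induction i) (auto simp: matrix_vector_mult_diff_distrib)

lemma mv_iter_scalar: "mv_iter A i (c *s v) = c *s mv_iter A i v"
  by (induction i) (auto simp: vector_scalar_commute)

lemma linear_matrix_vector_left: "linear (\<lambda>B. B *v v)"
  for v :: "'a::real_algebra_1^'n"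
  by (rule linearI) (simp_all add: vec_eq_iff matrix_vector_mult_def scaleR_sum_right algebra_simps sum.distrib)

text \<open>
  The powers of A lie in a finite-dimensional real space, so they satisfy a nontrivial linear
  relation; its (real) coefficients are those of p.
\<close>

lemma annihilating_polynomial:
  fixes A :: "complex^'n^'n"
  obtains p :: "complex poly" where "p \<noteq> 0"
    "\<And>v. (\<Sum>i\<le>degree p. coeff p i *s mv_iter A i v) = 0"
proof -
  define B where "B = (\<lambda>i. (((**) A) ^^ i) (mat 1))"
  have B: "B i *v v = mv_iter A i v" for i v
    by (induction i) (auto simp: B_def simp flip: matrix_vector_mul_assoc)
  obtain c n where c: "\<exists>i\<le>n. c i \<noteq> 0" "(\<Sum>i\<le>n. c i *\<^sub>R B i) = 0"
    using exists_nontrivial_combination[of B] by blast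
  define p :: "complex poly" where "p = (\<Sum>i\<le>n. monom (complex_of_real (c i)) i)"
  have coeff_p: "coeff p i = (if i \<le> n then of_real (c i) else 0)" for i
    by (auto simp: p_def coeff_sum if_distrib cong: if_cong)
  have "p \<noteq> 0" using c(1) coeff_p by (metis coeff_0 of_real_eq_0_iff)
  moreover have "(\<Sum>i\<le>degree p. coeff p i *s mv_iter A i v) = 0" for v
  proof -
    have "degree p \<le> n" by (rule degree_le) (simp add: coeff_p)
    have "(\<Sum>i\<le>degree p. coeff p i *s mv_iter A i v) = (\<Sum>i\<le>n. coeff p i *s mv_iter A i v)"
      using \<open>degree p \<le> n\<close> by (intro sum.mono_neutral_left) (auto simp: coeff_eq_0)
    also have "\<dots> = (\<Sum>i\<le>n. c i *\<^sub>R (B i *v v))"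
      by (intro sum.cong refl) (auto simp: coeff_p B vec_eq_iff scaleR_conv_of_real[where 'a=complex])
    also have "\<dots> = (\<Sum>i\<le>n. c i *\<^sub>R B i) *v v"
      by (simp add: linear_sum[OF linear_matrix_vector_left] linear_cmul[OF linear_matrix_vector_left])
    finally show ?thesis by (simp add: c(2))
  qed
  ultimately show ?thesis using that by blast
qed

text \<open>
  The product of the operators A - l over a list of scalars, applied to a vector. The head of the list is
  applied first, so that the remaining product acts on the vector A v - l v, to which an induction
  hypothesis for the tail applies.
\<close>

fun root_prod :: "complex^'n^'n \<Rightarrow> complex list \<Rightarrow> complex^'n \<Rightarrow> complex^'n" where
  "root_prod A [] v = v"
| "root_prod A (l # ls) v = root_prod A ls (A *v v - l *s v)"

text \<open>
  Induction on the degree: a root l of p gives p = (X - l) q, and evaluating at A turns the factor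
  X - l into the substitution of A v - l v for v.
\<close>

lemma polynomial_splits_at_matrix:
  fixes A :: "complex^'n^'n"
  assumes "p \<noteq> 0"
  shows "\<exists>c ls. c \<noteq> 0 \<and> (\<forall>v. (\<Sum>i\<le>degree p. coeff p i *s mv_iter A i v) = c *s root_prod A ls v)"
  using assms
proof (induction "degree p" arbitrary: p)
  case 0
  then obtain a where "p = [:a:]" "a \<noteq> 0" by (metis degree_0_id pCons_0_0)
  then show ?case by (intro exI[of _ a] exI[of _ "[]"]) auto
next
  case (Suc n)
  then have "\<not> constant (poly p)" by (simp add: constant_degree)
  then obtain l where "poly p l = 0" using fundamental_theorem_of_algebra by blast
  then obtain q where q: "p = [:-l, 1:] * q" by (metis poly_eq_0_iff_dvd dvdE)
  have "q \<noteq> 0" using Suc q by auto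
  then have dq: "degree q = n" using Suc(2) unfolding q by (subst (asm) degree_mult_eq) auto
  obtain c ls where c: "c \<noteq> 0"
    "\<And>v. (\<Sum>i\<le>degree q. coeff q i *s mv_iter A i v) = c *s root_prod A ls v"
    using Suc(1)[OF dq[symmetric] \<open>q \<noteq> 0\<close>] by auto
  have "(\<Sum>i\<le>degree p. coeff p i *s mv_iter A i v) = c *s root_prod A (l # ls) v" for v
  proof -
    have cp: "p = pCons 0 q - smult l q" by (simp add: q)
    have "(\<Sum>i\<le>degree p. coeff p i *s mv_iter A i v)
        = (\<Sum>i\<le>Suc n. coeff (pCons 0 q) i *s mv_iter A i v) - (\<Sum>i\<le>Suc n. (l * coeff q i) *s mv_iter A i v)"
      unfolding Suc(2)[symmetric] by (subst cp) (simp add: vector_sub_rdistrib sum_subtractf)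
    also have "(\<Sum>i\<le>Suc n. coeff (pCons 0 q) i *s mv_iter A i v) = (\<Sum>i\<le>n. coeff q i *s mv_iter A i (A *v v))"
      by (subst sum.atMost_Suc_shift) (simp add: funpow_swap1)
    also have "(\<Sum>i\<le>Suc n. (l * coeff q i) *s mv_iter A i v) = (\<Sum>i\<le>n. coeff q i *s mv_iter A i (l *s v))"
      using dq by (auto simp: coeff_eq_0 mv_iter_scalar vector_smult_assoc mult.commute)
    also have "(\<Sum>i\<le>n. coeff q i *s mv_iter A i (A *v v)) - (\<Sum>i\<le>n. coeff q i *s mv_iter A i (l *s v))
        = (\<Sum>i\<le>n. coeff q i *s mv_iter A i (A *v v - l *s v))"
      by (simp add: mv_iter_diff vector_ssub_ldistrib sum_subtractf)
    also have "\<dots> = c *s root_prod A (l # ls) v" using c(2) dq by simp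
    finally show ?thesis .
  qed
  then show ?case using c(1) by blast
qed

lemma matrix_annihilated_by_root_prod:
  fixes A :: "complex^'n^'n"
  obtains ls where "\<And>v. root_prod A ls v = 0"
proof -
  obtain p where "p \<noteq> 0" "\<And>v. (\<Sum>i\<le>degree p. coeff p i *s mv_iter A i v) = 0"
    using annihilating_polynomial[of A] by blast
  with polynomial_splits_at_matrix[of p A] that show ?thesis
    by (metis vector_mul_eq_0)
qed

lemma mv_iter_eigenvector:
  "A *v v = l *s v \<Longrightarrow> mv_iter A i v = l ^ i *s v"
  by (induction i) (auto simp: vector_scalar_commute vector_smult_assoc mult.commute)

text \<open>
  Every eigenvalue is a root of the annihilating polynomial.
\<close>

lemma finite_eigenvalues:
  fixes A :: "complex^'n^'n"
  shows "finite {l. \<exists>v. v \<noteq> 0 \<and> A *v v = l *s v}"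
proof -
  obtain p where p: "p \<noteq> 0" "\<And>v. (\<Sum>i\<le>degree p. coeff p i *s mv_iter A i v) = 0"
    using annihilating_polynomial[of A] by blast
  have "poly p l = 0" if "v \<noteq> 0" "A *v v = l *s v" for l v
  proof -
    have "(\<Sum>i\<le>degree p. coeff p i *s mv_iter A i v) = poly p l *s v"
      unfolding poly_altdef mv_iter_eigenvector[OF that(2)]
      by (simp add: vec_eq_iff sum_distrib_right mult.assoc)
    then show ?thesis using p(2) that(1) by (metis vector_mul_eq_0)
  qed
  then have "{l. \<exists>v. v \<noteq> 0 \<and> A *v v = l *s v} \<subseteq> {l. poly p l = 0}" by auto
  then show ?thesis using poly_roots_finite[OF p(1)] finite_subset by blast
qed

text \<open>
  A product of factors A - l that kills a nonzero vector contains a factor with nontrivial kernel.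
\<close>

lemma eigenvalue_exists:
  fixes A :: "complex^'n^'n"
  obtains l v where "v \<noteq> 0" "A *v v = l *s v"
proof -
  obtain ls where ls: "\<And>v. root_prod A ls v = 0" using matrix_annihilated_by_root_prod[of A] by blast
  have *: "\<exists>l w. w \<noteq> 0 \<and> A *v w = l *s w" if "root_prod A ls v = 0" "v \<noteq> 0" for v ls
    using that
  proof (induction ls arbitrary: v)
    case (Cons l ls)
    then show ?case by (cases "A *v v - l *s v = 0") auto
  qed simp
  have "(1 :: complex^'n) \<noteq> 0" by simp
  then show ?thesis using * ls that by blast
qed

text \<open>
  These two facts make the maximum in the definition of the spectral radius a genuine one.
\<close>

lemma spectrum_finite: "finite (spectrum M)" and spectrum_nonempty: "spectrum M \<noteq> {}"
  unfolding spectrum_def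
  by (rule finite_eigenvalues) (rule eigenvalue_exists[of "map_matrix complex_of_real M"], blast)

lemma spectral_radius_attained:
  obtains l v where "cmod l = spectral_radius M" "v \<noteq> 0" "map_matrix complex_of_real M *v v = l *s v"
proof -
  have "spectral_radius M \<in> cmod ` spectrum M"
    unfolding spectral_radius_def using spectrum_finite spectrum_nonempty by (intro Max_in) auto
  then show ?thesis using that by (auto simp: spectrum_def)
qed

lemma cmod_eigenvalue_le_spectral_radius: "l \<in> spectrum M \<Longrightarrow> cmod l \<le> spectral_radius M"
  unfolding spectral_radius_def using spectrum_finite by (intro Max_ge) auto

lemma spectral_radius_nonneg: "0 \<le> spectral_radius M"
  by (metis norm_ge_zero spectral_radius_attained)

lemma geometric_bound_step:
  fixes a :: "nat \<Rightarrow> real"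
  assumes "\<And>n. a (Suc n) \<le> \<rho> * a n + C * r ^ n" "0 \<le> \<rho>" "\<rho> < r" "0 \<le> C"
  shows "\<exists>K\<ge>0. \<forall>n. a n \<le> K * r ^ n"
proof -
  (* This K starts the induction and makes \<rho> K + C at most K r. *)
  define K where "K = max \<bar>a 0\<bar> (C / (r - \<rho>))"
  have CK: "C \<le> K * (r - \<rho>)" using assms by (simp add: K_def flip: pos_divide_le_eq)
  have "a n \<le> K * r ^ n" for n
  proof (induction n)
    case (Suc n)
    have "a (Suc n) \<le> \<rho> * (K * r ^ n) + C * r ^ n"
      using assms(1)[of n] mult_left_mono[OF Suc assms(2)] by linarith
    also have "\<dots> \<le> \<rho> * (K * r ^ n) + K * (r - \<rho>) * r ^ n"
      using CK assms by (intro add_left_mono mult_right_mono) auto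
    also have "\<dots> = K * r ^ Suc n" by (simp add: algebra_simps)
    finally show ?case .
  qed (simp add: K_def)
  moreover have "0 \<le> K" by (simp add: K_def)
  ultimately show ?thesis by blast
qed

text \<open>
  Induction on the number of factors killing v. The vector w = (A - l) v needs one factor less, so
  A^n w is O(r^n). If l is an eigenvalue, then A^(n+1) v = l A^n v + A^n w with |l| \<le> \<rho> < r, and
  the resulting recursive inequality keeps the rate r^n. If l is not an eigenvalue, A - l is bounded
  below and |A^n v| is at most a constant times |A^n w|. The
  gap between \<rho> and r absorbs the powers of n which nontrivial Jordan blocks produce.
\<close>

lemma root_prod_growth:
  fixes A :: "complex^'n^'n"
  assumes eig: "\<And>l v. v \<noteq> 0 \<Longrightarrow> A *v v = l *s v \<Longrightarrow> cmod l \<le> \<rho>" and r: "0 \<le> \<rho>" "\<rho> < r"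
    and "root_prod A ls v = 0"
  shows "\<exists>C\<ge>0. \<forall>n. norm (mv_iter A n v) \<le> C * r ^ n"
  using assms(4)
proof (induction ls arbitrary: v)
  case Nil
  then show ?case using r
    by (intro exI[of _ 1]) (simp add: mv_iter_eigenvector[of A 0 0] norm_complex_scalar_mult)
next
  case (Cons l ls)
  define w where "w = A *v v - l *s v"
  obtain C where C: "C \<ge> 0" "\<And>n. norm (mv_iter A n w) \<le> C * r ^ n"
    using Cons.IH[of w] Cons.prems by (auto simp: w_def)
  have w: "mv_iter A n w = A *v mv_iter A n v - l *s mv_iter A n v" for n
    by (simp add: w_def mv_iter_diff mv_iter_scalar funpow_swap1)
  show ?case
  proof (cases "\<exists>x. x \<noteq> 0 \<and> A *v x = l *s x")
    case True
    then have l: "cmod l \<le> \<rho>" using eig by blast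
    have "norm (mv_iter A (Suc n) v) \<le> \<rho> * norm (mv_iter A n v) + C * r ^ n" for n
    proof -
      have "mv_iter A (Suc n) v = l *s mv_iter A n v + mv_iter A n w" by (simp add: w)
      then have "norm (mv_iter A (Suc n) v) \<le> cmod l * norm (mv_iter A n v) + C * r ^ n"
        using norm_triangle_ineq[of "l *s mv_iter A n v" "mv_iter A n w"] C(2)[of n]
        by (simp add: norm_complex_scalar_mult)
      then show ?thesis using mult_right_mono[OF l, of "norm (mv_iter A n v)"] by simp
    qed
    then show ?thesis by (rule geometric_bound_step[OF _ r C(1)])
  next
    case False
    define f where "f = (\<lambda>x. A *v x - l *s x)"
    have lin: "linear f"
      by (rule linearI) (simp_all add: f_def vec_eq_iff matrix_vector_mult_def algebra_simps scaleR_sum_right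
         sum.distrib)
    have "inj f" unfolding linear_injective_0[OF lin] using False by (auto simp: f_def)
    then obtain k where k: "k > 0" "\<And>x. k * norm x \<le> norm (f x)"
      using linear_inj_bounded_below_pos[OF lin] by blast
    have "norm (mv_iter A n v) \<le> C / k * r ^ n" for n
    proof -
      have "k * norm (mv_iter A n v) \<le> C * r ^ n"
        using k(2)[of "mv_iter A n v"] C(2)[of n] by (simp add: f_def w)
      then show ?thesis using k(1) by (simp add: field_simps)
    qed
    then show ?thesis using k C by (intro exI[of _ "C / k"]) auto
  qed
qed

text \<open>
  Real vectors are embedded in the complex space on which the spectrum is defined, and recovered by
  taking real parts; both maps intertwine M with its complexification.
\<close>

definition cvec :: "real^'n \<Rightarrow> complex^'n" where "cvec x = (\<chi> i. complex_of_real (x $ i))"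

definition re_vec :: "complex^'n \<Rightarrow> real^'n" where "re_vec v = (\<chi> i. Re (v $ i))"

lemma norm_cvec: "norm (cvec x) = norm x"
  by (simp add: norm_vec_def cvec_def)

lemma map_matrix_cvec: "map_matrix complex_of_real M *v cvec x = cvec (M *v x)"
  by (simp add: vec_eq_iff cvec_def matrix_vector_mult_def)

lemma re_vec_map_matrix: "re_vec (map_matrix complex_of_real M *v v) = M *v re_vec v"
  by (simp add: vec_eq_iff re_vec_def matrix_vector_mult_def)

lemma matpow_0: "matpow M 0 = mat 1"
  and matpow_Suc: "matpow M (Suc n) = M ** matpow M n"
  by (simp_all add: matpow_def)

lemma matpow_add: "matpow M (m + n) = matpow M m ** matpow M n"
  by (induction m) (simp_all add: matpow_0 matpow_Suc matrix_mul_assoc)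

lemma matpow_Suc_right: "matpow M (Suc n) = matpow M n ** M"
  using matpow_add[of M n 1] by (simp add: matpow_Suc matpow_0)

lemma matpow_transpose: "matpow (transpose M) n = transpose (matpow M n)"
  by (induction n) (simp add: matpow_0, metis matpow_Suc matpow_Suc_right matrix_transpose_mul)

lemma mv_iter_cvec: "mv_iter (map_matrix complex_of_real M) n (cvec x) = cvec (matpow M n *v x)"
  by (induction n) (auto simp: matpow_0 matpow_Suc map_matrix_cvec simp flip: matrix_vector_mul_assoc)

lemma matpow_vector_growth:
  fixes M :: "real^'n^'n"
  assumes "spectral_radius M < r"
  shows "\<exists>C\<ge>0. \<forall>n. norm (matpow M n *v x) \<le> C * r ^ n"
proof -
  obtain ls where "\<And>v. root_prod (map_matrix complex_of_real M) ls v = 0"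
    using matrix_annihilated_by_root_prod[of "map_matrix complex_of_real M"] by blast
  then have "\<exists>C\<ge>0. \<forall>n. norm (mv_iter (map_matrix complex_of_real M) n (cvec x)) \<le> C * r ^ n"
    using assms spectral_radius_nonneg
    by (intro root_prod_growth[where \<rho> = "spectral_radius M"] cmod_eigenvalue_le_spectral_radius)
       (auto simp: spectrum_def)
  then show ?thesis by (simp add: mv_iter_cvec norm_cvec)
qed

lemma matpow_growth:
  fixes M :: "real^'n^'n"
  assumes "spectral_radius M < r"
  shows "\<exists>C\<ge>0. \<forall>n x. norm (matpow M n *v x) \<le> C * r ^ n * norm x"
proof -
  obtain C where C: "\<And>b. C b \<ge> 0" "\<And>b n. norm (matpow M n *v b) \<le> C b * r ^ n"
    using matpow_vector_growth[OF assms] by metis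
  define K where "K = (\<Sum>b\<in>Basis. C b)"
  have "norm (matpow M n *v x) \<le> K * r ^ n * norm x" for n x
  proof -
    have "matpow M n *v x = matpow M n *v (\<Sum>b\<in>Basis. (x \<bullet> b) *\<^sub>R b)" by (simp add: euclidean_representation)
    also have "\<dots> = (\<Sum>b\<in>Basis. (x \<bullet> b) *\<^sub>R (matpow M n *v b))"
      by (simp add: linear_sum[OF matrix_vector_mul_linear] matrix_vector_mult_scaleR)
    finally have "norm (matpow M n *v x) \<le> (\<Sum>b\<in>Basis. norm ((x \<bullet> b) *\<^sub>R (matpow M n *v b)))"
      using norm_sum by metis
    also have "\<dots> \<le> (\<Sum>b\<in>Basis. norm x * (C b * r ^ n))"
      by (intro sum_mono) (simp, intro mult_mono C Basis_le_norm, auto)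
    finally show ?thesis by (simp add: K_def sum_distrib_right sum_distrib_left mult_ac)
  qed
  moreover have "0 \<le> K" using C by (simp add: K_def sum_nonneg)
  ultimately show ?thesis by blast
qed

text \<open>
  Let v be an eigenvector for an eigenvalue l with |l| = \<rho>. The real-linear map sending c to
  Re (c v) intertwines multiplication by l with M. If it is injective, it is bounded below, and
  M^n Re v = Re (l^n v) has size at least k |l|^n for every n; in particular the rotating phase of
  l^n cannot make it small. Otherwise some multiple of v is purely imaginary, which gives a real
  eigenvector of M.
\<close>

lemma spectral_radius_growth_attained:
  fixes M :: "real^'n^'n"
  obtains z k where "k > 0" "\<And>n. k * spectral_radius M ^ n \<le> norm (matpow M n *v z)"
proof -
  obtain l v where l: "cmod l = spectral_radius M" "v \<noteq> 0" "map_matrix complex_of_real M *v v = l *s v"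
    by (rule spectral_radius_attained)
  define f where "f = (\<lambda>c. re_vec (c *s v))"
  have lin: "linear f"
    by (rule linearI) (auto simp: f_def re_vec_def vec_eq_iff algebra_simps)
  have Mf: "M *v f c = f (l * c)" for c
    unfolding f_def by (simp add: vector_scalar_commute l(3) vector_smult_assoc mult.commute flip: re_vec_map_matrix)
  have Mpow: "matpow M n *v f c = f (l ^ n * c)" for n c
    by (induction n) (auto simp: matpow_0 matpow_Suc Mf mult.assoc simp flip: matrix_vector_mul_assoc)
  show ?thesis
  proof (cases "inj f")
    case True
    then obtain k where k: "k > 0" "\<And>c. k * norm c \<le> norm (f c)"
      using linear_inj_bounded_below_pos[OF lin] by blast
    have "k * spectral_radius M ^ n \<le> norm (matpow M n *v f 1)" for n
      using k(2)[of "l ^ n"] by (simp add: Mpow norm_power l(1))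
    then show ?thesis using that k(1) by blast
  next
    case False
    then obtain c where c: "c \<noteq> 0" "f c = 0" by (auto simp: linear_injective_0[OF lin])
    define w where "w = f (\<i> * c)"
    (* Re (c v) = 0, so c v is i times its imaginary part, which is -w. *)
    have "c *s v = (- \<i>) *s cvec w"
      using c(2) by (auto simp: w_def f_def cvec_def re_vec_def vec_eq_iff complex_eq_iff)
    then obtain u where cv: "c *s v = u *s cvec w" and u: "u \<noteq> 0" by (metis complex_i_not_zero neg_equal_0_iff_equal)
    have w0: "w \<noteq> 0"
    proof
      assume "w = 0"
      then have "c *s v = 0" unfolding cv by (simp add: vec_eq_iff cvec_def)
      then show False using c(1) l(2) by (simp only: vector_mul_eq_0) auto
    qed
    have "map_matrix complex_of_real M *v (c *s v) = l *s (c *s v)"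
      by (simp add: vector_scalar_commute l(3) vector_smult_assoc mult.commute)
    then have "u *s cvec (M *v w) = u *s (l *s cvec w)"
      unfolding cv by (simp add: vector_scalar_commute map_matrix_cvec vector_smult_assoc mult.commute)
    then have "cvec (M *v w) = l *s cvec w" using u by (simp only: vector_mul_lcancel) auto
    then have *: "map_matrix complex_of_real M *v cvec w = l *s cvec w" by (simp add: map_matrix_cvec)
    have "norm (matpow M n *v w) = spectral_radius M ^ n * norm w" for n
      using arg_cong[OF mv_iter_eigenvector[OF *], of norm n]
      by (simp add: mv_iter_cvec norm_cvec norm_complex_scalar_mult norm_power l(1))
    then show ?thesis using that[of "norm w" w] w0 by (simp add: mult.commute)
  qed
qed

section \<open>Total variation distance\<close>

abbreviation borel_probs :: "'a::topological_space measure set" where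
  "borel_probs \<equiv> space (prob_algebra borel)"

lemma borel_probsD:
  assumes "\<mu> \<in> borel_probs"
  shows "prob_space \<mu>" "sets \<mu> = sets borel" "space \<mu> = UNIV" "measurable \<mu> N = measurable borel N"
  using assms sets_eq_imp_space_eq[of \<mu> borel] by (auto simp: space_prob_algebra cong: measurable_cong_sets)

lemma integrable_bounded_on_prob:
  fixes f :: "'a::topological_space \<Rightarrow> real"
  assumes "\<mu> \<in> borel_probs" "f \<in> borel_measurable borel" "\<And>x. \<bar>f x\<bar> \<le> B"
  shows "integrable \<mu> f"
proof -
  interpret prob_space \<mu> using borel_probsD[OF assms(1)] by simp
  show ?thesis using assms borel_probsD(4)[OF assms(1)]
    by (intro integrable_const_bound[where B=B]) auto
qed

lemma abs_measure_diff_le_1: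
  assumes "\<mu> \<in> borel_probs" "\<nu> \<in> borel_probs"
  shows "\<bar>measure \<mu> A - measure \<nu> A\<bar> \<le> 1"
  using prob_space.prob_le_1[OF borel_probsD(1)[OF assms(1)], of A]
    prob_space.prob_le_1[OF borel_probsD(1)[OF assms(2)], of A]
    measure_nonneg[of \<mu> A] measure_nonneg[of \<nu> A] by linarith

lemma tv_dist_upper:
  assumes "\<mu> \<in> borel_probs" "\<nu> \<in> borel_probs" "A \<in> sets borel"
  shows "\<bar>measure \<mu> A - measure \<nu> A\<bar> \<le> tv_dist \<mu> \<nu>"
  unfolding tv_dist_def
  using assms(3) abs_measure_diff_le_1[OF assms(1,2)] by (intro cSUP_upper) (auto intro!: bdd_aboveI[where M=1])

lemma tv_dist_least:
  assumes "\<And>A. A \<in> sets borel \<Longrightarrow> \<bar>measure \<mu> A - measure \<nu> A\<bar> \<le> e"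
  shows "tv_dist \<mu> \<nu> \<le> e"
  unfolding tv_dist_def using assms by (intro cSUP_least) auto

lemma tv_dist_commute: "tv_dist \<mu> \<nu> = tv_dist \<nu> \<mu>"
  unfolding tv_dist_def by (simp add: abs_minus_commute)

lemma tv_dist_nonneg: "\<mu> \<in> borel_probs \<Longrightarrow> \<nu> \<in> borel_probs \<Longrightarrow> 0 \<le> tv_dist \<mu> \<nu>"
  using tv_dist_upper[of \<mu> \<nu> "{}"] by simp

lemma tv_dist_triangle:
  assumes "\<mu> \<in> borel_probs" "\<nu> \<in> borel_probs" "\<kappa> \<in> borel_probs"
  shows "tv_dist \<mu> \<kappa> \<le> tv_dist \<mu> \<nu> + tv_dist \<nu> \<kappa>"
proof (rule tv_dist_least)
  fix A :: "'a set" assume "A \<in> sets borel"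
  then show "\<bar>measure \<mu> A - measure \<kappa> A\<bar> \<le> tv_dist \<mu> \<nu> + tv_dist \<nu> \<kappa>"
    using tv_dist_upper[OF assms(1,2), of A] tv_dist_upper[OF assms(2,3), of A] by linarith
qed

text \<open>
  A function f with values in [0, 1] is within 1/n of the average of the indicators of its n
  superlevel sets at heights k/n, and each of these sets is compared by the total variation distance.
\<close>

lemma integral_diff_le_tv_dist:
  fixes f :: "'a::topological_space \<Rightarrow> real"
  assumes \<mu>: "\<mu> \<in> borel_probs" and \<nu>: "\<nu> \<in> borel_probs"
    and f[measurable]: "f \<in> borel_measurable borel" and f01: "\<And>x. 0 \<le> f x" "\<And>x. f x \<le> 1"
  shows "\<bar>(\<integral>x. f x \<partial>\<mu>) - (\<integral>x. f x \<partial>\<nu>)\<bar> \<le> tv_dist \<mu> \<nu>"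
proof -
  have approx: "\<bar>(\<integral>x. f x \<partial>\<mu>) - (\<integral>x. f x \<partial>\<nu>)\<bar> \<le> tv_dist \<mu> \<nu> + 2 / real n" if n: "n \<ge> 1" for n :: nat
  proof -
    define S where "S k = {x. real k \<le> real n * f x}" for k :: nat
    have S[measurable]: "S k \<in> sets borel" for k unfolding S_def by measurable
    define g where "g x = (\<Sum>k=1..n. indicator (S k) x) / real n" for x
    have g_eq: "g x = real (nat \<lfloor>real n * f x\<rfloor>) / real n" for x
    proof -
      have "real n * f x \<le> real n" using f01(2)[of x] by (simp add: mult_left_le)
      then have le: "nat \<lfloor>real n * f x\<rfloor> \<le> n" by linarith
      have iff: "real k \<le> real n * f x \<longleftrightarrow> k \<le> nat \<lfloor>real n * f x\<rfloor>" for k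
        using f01(1)[of x] by (auto simp: le_nat_iff le_floor_iff)
      have "{k\<in>{1..n}. x \<in> S k} = {1..nat \<lfloor>real n * f x\<rfloor>}"
        unfolding S_def mem_Collect_eq iff using le by auto
      then show ?thesis
        by (simp add: g_def indicator_def sum.If_cases Int_def)
    qed
    have g1: "g x \<le> f x" and g2: "f x \<le> g x + 1 / real n" for x
    proof -
      have *: "real (nat \<lfloor>real n * f x\<rfloor>) \<le> real n * f x" "real n * f x \<le> real (nat \<lfloor>real n * f x\<rfloor>) + 1"
        using f01(1)[of x] by (auto simp: of_nat_floor)
      show "g x \<le> f x" "f x \<le> g x + 1 / real n"
        using * n by (auto simp: g_eq field_simps)
    qed
    have g0: "0 \<le> g x" for x by (simp add: g_eq)
    have [measurable]: "g \<in> borel_measurable borel" unfolding g_def by measurable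
    have int: "integrable \<kappa> f" "integrable \<kappa> g" if "\<kappa> \<in> borel_probs" for \<kappa>
    proof -
      have "\<bar>f x\<bar> \<le> 1" "\<bar>g x\<bar> \<le> 1" for x using f01[of x] g0[of x] g1[of x] by auto
      then show "integrable \<kappa> f" "integrable \<kappa> g"
        using integrable_bounded_on_prob[OF that, of f 1] integrable_bounded_on_prob[OF that, of g 1] by auto
    qed
    have close: "\<bar>(\<integral>x. f x \<partial>\<kappa>) - (\<integral>x. g x \<partial>\<kappa>)\<bar> \<le> 1 / real n" if \<kappa>: "\<kappa> \<in> borel_probs" for \<kappa>
    proof -
      interpret prob_space \<kappa> using borel_probsD[OF \<kappa>] by simp
      have "(\<integral>x. g x \<partial>\<kappa>) \<le> (\<integral>x. f x \<partial>\<kappa>)" using int[OF \<kappa>] g1 by (intro integral_mono) auto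
      moreover have "(\<integral>x. f x \<partial>\<kappa>) \<le> (\<integral>x. g x + 1 / real n \<partial>\<kappa>)"
        using int[OF \<kappa>] g2 by (intro integral_mono) auto
      moreover have "(\<integral>x. g x + 1 / real n \<partial>\<kappa>) = (\<integral>x. g x \<partial>\<kappa>) + 1 / real n"
        using int[OF \<kappa>] by (simp add: prob_space)
      ultimately show ?thesis by linarith
    qed
    have int_g: "(\<integral>x. g x \<partial>\<kappa>) = (\<Sum>k=1..n. measure \<kappa> (S k)) / real n" if \<kappa>: "\<kappa> \<in> borel_probs" for \<kappa>
    proof -
      interpret prob_space \<kappa> using borel_probsD[OF \<kappa>] by simp
      have [simp]: "S k \<in> sets \<kappa>" for k using borel_probsD(2)[OF \<kappa>] by simp
      have "(\<integral>x. (\<Sum>k=1..n. indicator (S k) x :: real) \<partial>\<kappa>) = (\<Sum>k=1..n. \<integral>x. indicator (S k) x \<partial>\<kappa>)"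
        by (intro Bochner_Integration.integral_sum) (simp add: emeasure_eq_measure)
      then show ?thesis unfolding g_def by (simp add: borel_probsD(3)[OF \<kappa>])
    qed
    have "\<bar>(\<integral>x. g x \<partial>\<mu>) - (\<integral>x. g x \<partial>\<nu>)\<bar> = \<bar>\<Sum>k=1..n. measure \<mu> (S k) - measure \<nu> (S k)\<bar> / real n"
      by (simp add: int_g \<mu> \<nu> sum_subtractf diff_divide_distrib[symmetric])
    also have "\<dots> \<le> (\<Sum>k=1..n. tv_dist \<mu> \<nu>) / real n"
      by (intro divide_right_mono order.trans[OF sum_abs] sum_mono tv_dist_upper \<mu> \<nu> S) auto
    also have "\<dots> = tv_dist \<mu> \<nu>" using n by simp
    finally show ?thesis using close[OF \<mu>] close[OF \<nu>] by (simp add: field_simps)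
  qed
  have "(\<lambda>n. tv_dist \<mu> \<nu> + 2 / real n) \<longlonglongrightarrow> tv_dist \<mu> \<nu> + 0"
    by (intro tendsto_intros lim_const_over_n)
  then show ?thesis
    using approx by (intro LIMSEQ_le_const[where X = "\<lambda>n. tv_dist \<mu> \<nu> + 2 / real n"]) auto
qed

text \<open>
  The factor 2 is the length of the range [-1, 1] of f.
\<close>

lemma signed_integral_diff_le_tv_dist:
  fixes f :: "'a::topological_space \<Rightarrow> real"
  assumes \<mu>: "\<mu> \<in> borel_probs" and \<nu>: "\<nu> \<in> borel_probs"
    and f[measurable]: "f \<in> borel_measurable borel" and f1: "\<And>x. \<bar>f x\<bar> \<le> 1"
  shows "\<bar>(\<integral>x. f x \<partial>\<mu>) - (\<integral>x. f x \<partial>\<nu>)\<bar> \<le> 2 * tv_dist \<mu> \<nu>"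
proof -
  have "\<bar>(\<integral>x. (1 + f x) / 2 \<partial>\<mu>) - (\<integral>x. (1 + f x) / 2 \<partial>\<nu>)\<bar> \<le> tv_dist \<mu> \<nu>"
  proof (intro integral_diff_le_tv_dist \<mu> \<nu>)
    fix x
    show "0 \<le> (1 + f x) / 2" "(1 + f x) / 2 \<le> 1" using f1[of x] by auto
  qed measurable
  moreover have "(\<integral>x. (1 + f x) / 2 \<partial>\<kappa>) = (1 + (\<integral>x. f x \<partial>\<kappa>)) / 2" if \<kappa>: "\<kappa> \<in> borel_probs" for \<kappa>
  proof -
    interpret prob_space \<kappa> using borel_probsD[OF \<kappa>] by simp
    show ?thesis using integrable_bounded_on_prob[OF \<kappa> f f1] by (simp add: prob_space)
  qed
  ultimately show ?thesis using \<mu> \<nu> by (simp add: field_simps)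
qed

lemma borel_probs_distr:
  assumes "\<mu> \<in> borel_probs" "T \<in> borel_measurable borel"
  shows "distr \<mu> borel T \<in> borel_probs"
  using assms borel_probsD(4)[OF assms(1)] prob_space.prob_space_distr[OF borel_probsD(1)[OF assms(1)], of T borel]
  by (auto simp: space_prob_algebra)

lemma tv_dist_distr_le:
  fixes T :: "'a::topological_space \<Rightarrow> 'b::topological_space"
  assumes \<mu>: "\<mu> \<in> borel_probs" and \<nu>: "\<nu> \<in> borel_probs" and T[measurable]: "T \<in> borel_measurable borel"
  shows "tv_dist (distr \<mu> borel T) (distr \<nu> borel T) \<le> tv_dist \<mu> \<nu>"
proof (rule tv_dist_least)
  fix A :: "'b set" assume A[measurable]: "A \<in> sets borel"
  have "T -` A \<in> sets borel" using measurable_sets[OF T A] by simp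
  then show "\<bar>measure (distr \<mu> borel T) A - measure (distr \<nu> borel T) A\<bar> \<le> tv_dist \<mu> \<nu>"
    using tv_dist_upper[OF \<mu> \<nu>, of "T -` A"]
    by (simp add: measure_distr borel_probsD[OF \<mu>] borel_probsD[OF \<nu>])
qed

lemma borel_probs_kernel:
  assumes "\<kappa> \<in> borel \<rightarrow>\<^sub>M prob_algebra borel"
  shows "\<kappa> y \<in> borel_probs"
  using measurable_space[OF assms, of y] by simp

lemma kernel_measurable_on:
  assumes "\<mu> \<in> borel_probs" "\<kappa> \<in> borel \<rightarrow>\<^sub>M prob_algebra borel"
  shows "\<kappa> \<in> \<mu> \<rightarrow>\<^sub>M subprob_algebra borel"
  using measurable_prob_algebraD[OF assms(2)] by (simp add: borel_probsD(4)[OF assms(1)])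

lemma borel_probs_bind:
  assumes "\<mu> \<in> borel_probs" "\<kappa> \<in> borel \<rightarrow>\<^sub>M prob_algebra borel"
  shows "\<mu> \<bind> \<kappa> \<in> borel_probs"
  using prob_space_bind'[OF assms] sets_bind'[OF assms] by (simp add: space_prob_algebra)

lemma measure_bind_kernel:
  assumes "\<mu> \<in> borel_probs" "\<kappa> \<in> borel \<rightarrow>\<^sub>M prob_algebra borel" "A \<in> sets borel"
  shows "measure (\<mu> \<bind> \<kappa>) A = (\<integral>y. measure (\<kappa> y) A \<partial>\<mu>)"
  using prob_space_imp_subprob_space[OF borel_probsD(1)[OF assms(1)]]
    subprob_space.measure_bind kernel_measurable_on[OF assms(1,2)] assms(3) by blast

lemma measurable_kernel_measure:
  assumes "\<kappa> \<in> borel \<rightarrow>\<^sub>M prob_algebra borel" "A \<in> sets borel"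
  shows "(\<lambda>y. measure (\<kappa> y) A) \<in> borel_measurable borel"
  using measurable_compose[OF measurable_prob_algebraD[OF assms(1)] measurable_measure_subprob_algebra[OF assms(2)]] .

lemma tv_dist_bind_le:
  assumes \<mu>: "\<mu> \<in> borel_probs" and \<nu>: "\<nu> \<in> borel_probs" and \<kappa>: "\<kappa> \<in> borel \<rightarrow>\<^sub>M prob_algebra borel"
  shows "tv_dist (\<mu> \<bind> \<kappa>) (\<nu> \<bind> \<kappa>) \<le> tv_dist \<mu> \<nu>"
proof (rule tv_dist_least)
  fix A :: "'b set" assume A: "A \<in> sets borel"
  show "\<bar>measure (\<mu> \<bind> \<kappa>) A - measure (\<nu> \<bind> \<kappa>) A\<bar> \<le> tv_dist \<mu> \<nu>"
    unfolding measure_bind_kernel[OF \<mu> \<kappa> A] measure_bind_kernel[OF \<nu> \<kappa> A]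
    using prob_space.prob_le_1[OF borel_probsD(1)[OF borel_probs_kernel[OF \<kappa>]]]
    by (intro integral_diff_le_tv_dist \<mu> \<nu> measurable_kernel_measure[OF \<kappa> A]) auto
qed

text \<open>
  The kernels are compared at each point y, and the distance of the mixtures is at most the average
  of the pointwise distances.
\<close>

lemma tv_dist_bind_kernels_le:
  assumes \<mu>: "\<mu> \<in> borel_probs" and \<kappa>: "\<kappa> \<in> borel \<rightarrow>\<^sub>M prob_algebra borel" "\<kappa>' \<in> borel \<rightarrow>\<^sub>M prob_algebra borel"
    and b: "integrable \<mu> b" "\<And>y. tv_dist (\<kappa> y) (\<kappa>' y) \<le> b y"
  shows "tv_dist (\<mu> \<bind> \<kappa>) (\<mu> \<bind> \<kappa>') \<le> (\<integral>y. b y \<partial>\<mu>)"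
proof (rule tv_dist_least)
  fix A :: "'b set" assume A: "A \<in> sets borel"
  have int: "integrable \<mu> (\<lambda>y. measure (\<kappa> y) A)" if "\<kappa> \<in> borel \<rightarrow>\<^sub>M prob_algebra borel"
    for \<kappa> :: "'a \<Rightarrow> 'b measure"
    using prob_space.prob_le_1[OF borel_probsD(1)[OF borel_probs_kernel[OF that]]]
    by (intro integrable_bounded_on_prob[where B=1] \<mu> measurable_kernel_measure[OF that A]) auto
  have "\<bar>measure (\<mu> \<bind> \<kappa>) A - measure (\<mu> \<bind> \<kappa>') A\<bar> = \<bar>\<integral>y. measure (\<kappa> y) A - measure (\<kappa>' y) A \<partial>\<mu>\<bar>"
    unfolding measure_bind_kernel[OF \<mu> \<kappa>(1) A] measure_bind_kernel[OF \<mu> \<kappa>(2) A]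
    using int \<kappa> by simp
  also have "\<dots> \<le> (\<integral>y. \<bar>measure (\<kappa> y) A - measure (\<kappa>' y) A\<bar> \<partial>\<mu>)" by (rule integral_abs_bound)
  also have "\<dots> \<le> (\<integral>y. b y \<partial>\<mu>)"
  proof (rule integral_mono)
    fix y
    show "\<bar>measure (\<kappa> y) A - measure (\<kappa>' y) A\<bar> \<le> b y"
      using tv_dist_upper[OF borel_probs_kernel[OF \<kappa>(1)] borel_probs_kernel[OF \<kappa>(2)] A, of y y] b(2)[of y]
      by linarith
  qed (use int \<kappa> b in auto)
  finally show "\<bar>measure (\<mu> \<bind> \<kappa>) A - measure (\<mu> \<bind> \<kappa>') A\<bar> \<le> (\<integral>y. b y \<partial>\<mu>)" .
qed

lemma tv_dist_mixture_le:
  assumes \<mu>: "\<mu> \<in> borel_probs" and \<nu>: "\<nu> \<in> borel_probs" and \<kappa>: "\<kappa> \<in> borel \<rightarrow>\<^sub>M prob_algebra borel"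
    and b: "integrable \<mu> b" "\<And>y. tv_dist \<nu> (\<kappa> y) \<le> b y"
  shows "tv_dist \<nu> (\<mu> \<bind> \<kappa>) \<le> (\<integral>y. b y \<partial>\<mu>)"
proof -
  have "\<mu> \<bind> (\<lambda>_. \<nu>) = \<nu>"
    using borel_probsD(1)[OF \<mu>] borel_probsD(1)[OF \<nu>] by (intro bind_const' prob_space_imp_subprob_space)
  then show ?thesis using tv_dist_bind_kernels_le[OF \<mu> measurable_const[OF \<nu>] \<kappa> b] by simp
qed

section \<open>The standard Gaussian measure\<close>

text \<open>
  This passes from the coordinates used in the definition of the Gaussian to the abstract basis over
  which Lebesgue measure is a product measure.
\<close>

lemma prod_components_eq_prod_Basis:
  fixes x :: "real^'k"
  shows "(\<Prod>i\<in>UNIV. f (x $ i)) = (\<Prod>b\<in>Basis. f (x \<bullet> b))"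
proof -
  have B: "(Basis :: (real^'k) set) = range (\<lambda>i. axis i 1)" by (auto simp: Basis_vec_def)
  have "inj (\<lambda>i :: 'k. axis i (1::real))" by (auto simp: inj_def axis_eq_axis)
  then show ?thesis unfolding B by (subst prod.reindex) (auto simp: inner_axis)
qed

definition gauss_dens :: "real^'k \<Rightarrow> real" where
  "gauss_dens x = (\<Prod>i\<in>UNIV. std_normal_density (x $ i))"

lemma std_gaussian_eq: "std_gaussian = density lborel (\<lambda>x. ennreal (gauss_dens x))"
  by (simp add: std_gaussian_def gauss_dens_def)

lemma gauss_dens_nonneg: "0 \<le> gauss_dens x"
  by (simp add: gauss_dens_def prod_nonneg)

lemma gauss_dens_measurable[measurable]: "gauss_dens \<in> borel_measurable borel"
  unfolding gauss_dens_def by measurable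

lemma sets_std_gaussian[simp, measurable_cong]: "sets std_gaussian = sets borel"
  and space_std_gaussian[simp]: "space std_gaussian = UNIV"
  by (simp_all add: std_gaussian_def)

lemma gauss_dens_total: "(\<integral>\<^sup>+x. ennreal (gauss_dens (x :: real^'k)) \<partial>lborel) = 1"
proof -
  have "(\<integral>\<^sup>+x. ennreal (gauss_dens (x :: real^'k)) \<partial>lborel)
      = (\<integral>\<^sup>+x. (\<Prod>b\<in>Basis. ennreal (std_normal_density ((x :: real^'k) \<bullet> b))) \<partial>lborel)"
    by (simp add: gauss_dens_def prod_components_eq_prod_Basis prod_ennreal)
  also have "\<dots> = (\<Prod>b\<in>(Basis :: (real^'k) set). (\<integral>\<^sup>+x. ennreal (std_normal_density x) \<partial>lborel))"
    by (subst nn_integral_lborel_prod) auto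
  also have "(\<integral>\<^sup>+x. ennreal (std_normal_density x) \<partial>lborel) = 1"
    by (simp add: nn_integral_eq_integral)
  finally show ?thesis by simp
qed

lemma std_gaussian_prob: "std_gaussian \<in> borel_probs"
proof -
  have "prob_space (std_gaussian :: (real^'k) measure)"
    by rule (simp add: std_gaussian_eq emeasure_density gauss_dens_total)
  then show ?thesis by (simp add: space_prob_algebra)
qed

lemma gauss_dens_shift: "gauss_dens (x - a) = gauss_dens x * exp (a \<bullet> x - a \<bullet> a / 2)"
proof -
  have "std_normal_density (s - t) = std_normal_density s * exp (t * s - t\<^sup>2 / 2)" for s t
    by (simp add: std_normal_density_def field_simps power2_eq_square flip: exp_add)
  then show ?thesis
    by (simp add: gauss_dens_def prod.distrib exp_sum inner_vec_def sum_subtractf sum_divide_distrib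
         power2_eq_square flip: exp_sum)
qed

lemma nn_integral_lborel_shift:
  fixes f :: "'a::euclidean_space \<Rightarrow> ennreal"
  assumes [measurable]: "f \<in> borel_measurable borel"
  shows "(\<integral>\<^sup>+x. f (a + x) \<partial>lborel) = (\<integral>\<^sup>+x. f x \<partial>lborel)"
  by (subst (2) lborel_distr_plus[of a, symmetric]) (simp add: nn_integral_distr)

text \<open>
  Lebesgue measure is translation invariant, so translating the Gaussian by a replaces its density
  at x by the density at x - a, which is an explicit multiple of the one at x.
\<close>

lemma std_gaussian_cameron_martin:
  "distr std_gaussian borel ((+) a) = density std_gaussian (\<lambda>x. ennreal (exp (a \<bullet> x - a \<bullet> a / 2)))"
    (is "?L = ?R")
proof (rule measure_eqI)
  fix A assume "A \<in> sets ?L"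
  then have A[measurable]: "A \<in> sets borel" by simp
  have "emeasure ?L A = (\<integral>\<^sup>+x. indicator A (a + x) \<partial>std_gaussian)"
    by (subst nn_integral_indicator[symmetric], simp, subst nn_integral_distr) auto
  also have "\<dots> = (\<integral>\<^sup>+x. ennreal (gauss_dens ((a + x) - a)) * indicator A (a + x) \<partial>lborel)"
    by (simp add: std_gaussian_eq nn_integral_density)
  also have "\<dots> = (\<integral>\<^sup>+x. ennreal (gauss_dens (x - a)) * indicator A x \<partial>lborel)"
    by (rule nn_integral_lborel_shift[of "\<lambda>x. ennreal (gauss_dens (x - a)) * indicator A x"]) measurable
  also have "\<dots> = (\<integral>\<^sup>+x. ennreal (gauss_dens x) * (ennreal (exp (a \<bullet> x - a \<bullet> a / 2)) * indicator A x) \<partial>lborel)"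
    by (simp add: gauss_dens_shift ennreal_mult' gauss_dens_nonneg mult.assoc)
  also have "\<dots> = emeasure ?R A"
    by (simp add: emeasure_density, simp add: std_gaussian_eq nn_integral_density)
  finally show "emeasure ?L A = emeasure ?R A" .
qed simp

text \<open>
  The Cameron-Martin density integrates to 1 because the translated measure is a probability
  measure.
\<close>

lemma has_bochner_integral_gaussian_exp:
  "has_bochner_integral std_gaussian (\<lambda>x :: real^'k. exp (a \<bullet> x)) (exp (a \<bullet> a / 2))"
proof -
  interpret prob_space "distr (std_gaussian :: (real^'k) measure) borel ((+) a)"
    using borel_probsD(1)[OF borel_probs_distr[OF std_gaussian_prob, of "(+) a"]] by simp
  have "(\<integral>\<^sup>+x. ennreal (exp (a \<bullet> x - a \<bullet> a / 2)) \<partial>std_gaussian) = 1"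
    using emeasure_space_1 unfolding std_gaussian_cameron_martin by (simp add: emeasure_density)
  then have "has_bochner_integral std_gaussian (\<lambda>x. exp (a \<bullet> x - a \<bullet> a / 2)) 1"
    by (intro has_bochner_integral_nn_integral) auto
  then have "has_bochner_integral std_gaussian (\<lambda>x. exp (a \<bullet> a / 2) * exp (a \<bullet> x - a \<bullet> a / 2)) (exp (a \<bullet> a / 2) * 1)"
    by (rule has_bochner_integral_mult_right) 
  then show ?thesis by (simp flip: exp_add)
qed

text \<open>
  With Z the Cameron-Martin density, the distance is at most the mean of |Z - 1|. As Z has
  mean 1 and second moment exp(|a|^2), the mean of (Z - 1)^2 is exp(|a|^2) - 1, which is at most
  2 |a|^2 for |a| \<le> 1. For |a| > 1 the claim is trivial.
\<close>

lemma tv_dist_gaussian_shift: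
  fixes a :: "real^'k"
  shows "tv_dist std_gaussian (distr std_gaussian borel ((+) a)) \<le> 3 / 2 * norm a"
proof (rule tv_dist_least)
  let ?G = "std_gaussian :: (real^'k) measure"
  fix A :: "(real^'k) set" assume A[measurable]: "A \<in> sets borel"
  interpret prob_space ?G using borel_probsD[OF std_gaussian_prob] by simp
  have distr_prob: "distr ?G borel ((+) a) \<in> borel_probs"
    by (intro borel_probs_distr std_gaussian_prob) auto
  show "\<bar>measure ?G A - measure (distr ?G borel ((+) a)) A\<bar> \<le> 3 / 2 * norm a"
  proof (cases "a = 0 \<or> norm a > 1")
    case True
    then show ?thesis
    proof
      assume "a = 0"
      then have "((+) a) = (\<lambda>x. x)" by auto
      then show ?thesis by (simp add: distr_id2)
    next
      assume "norm a > 1"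
      then show ?thesis using abs_measure_diff_le_1[OF std_gaussian_prob distr_prob, of A] by linarith
    qed
  next
    case False
    define c where "c = norm a"
    have c: "0 < c" "c \<le> 1" using False by (auto simp: c_def)
    have aa: "a \<bullet> a = c\<^sup>2" by (simp add: c_def power2_norm_eq_inner)
    define Z where "Z = (\<lambda>x. exp (a \<bullet> x - a \<bullet> a / 2))"
    have [measurable]: "Z \<in> borel_measurable borel" unfolding Z_def by measurable
    have Z1: "has_bochner_integral ?G Z 1"
    proof -
      have "has_bochner_integral ?G (\<lambda>x. exp (- (a \<bullet> a / 2)) * exp (a \<bullet> x)) (exp (- (a \<bullet> a / 2)) * exp (a \<bullet> a / 2))"
        by (intro has_bochner_integral_mult_right has_bochner_integral_gaussian_exp)
      then show ?thesis by (simp add: Z_def flip: exp_add)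
    qed
    have Z2: "has_bochner_integral ?G (\<lambda>x. (Z x)\<^sup>2) (exp (c\<^sup>2))"
    proof -
      have "has_bochner_integral ?G (\<lambda>x. exp (- (a \<bullet> a)) * exp ((2 *\<^sub>R a) \<bullet> x))
          (exp (- (a \<bullet> a)) * exp ((2 *\<^sub>R a) \<bullet> (2 *\<^sub>R a) / 2))"
        by (intro has_bochner_integral_mult_right has_bochner_integral_gaussian_exp)
      then show ?thesis by (simp add: Z_def aa power2_eq_square algebra_simps flip: exp_add)
    qed
    have Z: "integrable ?G Z" "integrable ?G (\<lambda>x. (Z x)\<^sup>2)" "(\<integral>x. Z x \<partial>?G) = 1" "(\<integral>x. (Z x)\<^sup>2 \<partial>?G) = exp (c\<^sup>2)"
      using Z1 Z2 by (auto simp: has_bochner_integral_iff)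
    have "measure (distr ?G borel ((+) a)) A = (\<integral>x. Z x * indicator A x \<partial>?G)"
    proof -
      have "measure (distr ?G borel ((+) a)) A = (\<integral>x. indicator A x \<partial>density ?G (\<lambda>x. ennreal (Z x)))"
        by (simp add: std_gaussian_cameron_martin Z_def)
      also have "\<dots> = (\<integral>x. Z x * indicator A x \<partial>?G)"
        by (subst integral_density) (auto simp: Z_def)
      finally show ?thesis .
    qed
    moreover have "measure ?G A = (\<integral>x. indicator A x \<partial>?G)" by simp
    moreover have ZA: "integrable ?G (\<lambda>x. Z x * indicator A x)"
      using integrable_mult_indicator[of A ?G Z] Z(1) by (simp add: mult.commute)
    moreover have IA: "integrable ?G (indicator A :: _ \<Rightarrow> real)" by (simp add: emeasure_eq_measure)
    ultimately have "\<bar>measure ?G A - measure (distr ?G borel ((+) a)) A\<bar>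
        = \<bar>\<integral>x. indicator A x - Z x * indicator A x \<partial>?G\<bar>" by simp
    also have "\<dots> \<le> (\<integral>x. \<bar>indicator A x - Z x * indicator A x\<bar> \<partial>?G)" by (rule integral_abs_bound)
    also have "\<dots> \<le> (\<integral>x. (((Z x)\<^sup>2 - 2 * Z x + 1) / c + c) / 2 \<partial>?G)"
    proof (rule integral_mono)
      fix x
      define y where "y = \<bar>Z x - 1\<bar>"
      have "\<bar>indicator A x - Z x * indicator A x\<bar> \<le> y"
        by (auto simp: y_def indicator_def)
      (* The arithmetic-geometric mean inequality, with the weight c = |a| because this is the order of
         the standard deviation of Z. *)
      also have "y \<le> (y\<^sup>2 / c + c) / 2"
      proof -
        have "0 \<le> (y - c)\<^sup>2" by simp
        then have "2 * y * c \<le> y\<^sup>2 + c\<^sup>2" by (simp add: power2_diff)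
        then show ?thesis using c by (simp add: field_simps power2_eq_square)
      qed
      also have "y\<^sup>2 = (Z x)\<^sup>2 - 2 * Z x + 1" by (simp add: y_def power2_diff)
      finally show "\<bar>indicator A x - Z x * indicator A x\<bar> \<le> (((Z x)\<^sup>2 - 2 * Z x + 1) / c + c) / 2" .
    qed (use ZA IA Z in auto)
    also have "\<dots> = ((exp (c\<^sup>2) - 1) / c + c) / 2"
      using Z prob_space by (simp add: field_simps)
    also have "\<dots> \<le> 3 / 2 * c"
    proof -
      have c2: "c\<^sup>2 \<le> 1" using c by (simp add: power_le_one)
      then have "exp (c\<^sup>2) \<le> 1 + c\<^sup>2 + (c\<^sup>2)\<^sup>2" by (intro exp_bound) auto
      also have "(c\<^sup>2)\<^sup>2 \<le> c\<^sup>2" using c2 by (simp add: power2_eq_square mult_left_le)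
      finally have "exp (c\<^sup>2) - 1 \<le> 2 * c * c" by (simp add: power2_eq_square)
      then have "(exp (c\<^sup>2) - 1) / c \<le> 2 * c" using c by (simp add: field_simps)
      then have "((exp (c\<^sup>2) - 1) / c + c) / 2 \<le> (2 * c + c) / 2"
        by (intro divide_right_mono add_right_mono) auto
      then show ?thesis by simp
    qed
    finally show ?thesis by (simp add: c_def)
  qed
qed

text \<open>
  Each component of G x is a linear functional of x and so is dominated by exponentials, which are
  integrable. The first moment enters when W(n) and W(n + 1) are compared.
\<close>

lemma std_gaussian_norm_integrable:
  fixes G :: "real^'k^'n"
  shows "integrable std_gaussian (\<lambda>x. norm (G *v x))"
proof (rule Bochner_Integration.integrable_bound)
  show "integrable std_gaussian (\<lambda>x. \<Sum>i\<in>UNIV. exp (row i G \<bullet> x) + exp ((- row i G) \<bullet> x))"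
    by (intro Bochner_Integration.integrable_sum Bochner_Integration.integrable_add
         integrable.intros[OF has_bochner_integral_gaussian_exp])
  show "(\<lambda>x. norm (G *v x)) \<in> borel_measurable std_gaussian"
    unfolding measurable_cong_sets[OF sets_std_gaussian refl]
    by (intro borel_measurable_continuous_onI continuous_on_norm linear_continuous_on
        matrix_vector_mul_bounded_linear)
  have "norm (G *v x) \<le> (\<Sum>i\<in>UNIV. exp (row i G \<bullet> x) + exp ((- row i G) \<bullet> x))" for x
  proof -
    have "\<bar>t\<bar> \<le> exp t + exp (- t)" for t :: real
      using exp_ge_add_one_self[of t] exp_ge_add_one_self[of "-t"] exp_gt_zero[of t] exp_gt_zero[of "-t"]
      by linarith
    then have "\<bar>(G *v x) $ i\<bar> \<le> exp (row i G \<bullet> x) + exp ((- row i G) \<bullet> x)" for i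
      by (simp add: matrix_vector_mul_component row_def vec_nth_inverse)
    then show ?thesis using norm_le_l1_cart[of "G *v x"] sum_mono order_trans by (smt (verit))
  qed
  then show "AE x in std_gaussian. norm (norm (G *v x)) \<le> norm (\<Sum>i\<in>UNIV. exp (row i G \<bullet> x) + exp ((- row i G) \<bullet> x))"
    unfolding real_norm_def abs_norm_cancel by (intro AE_I2 order.trans[OF _ abs_ge_self])
qed

text \<open>
  The family of integrals of cos(u \<bullet> x + \<theta>) carries the same information as the
  characteristic function, but is real; the phase \<theta> takes care of translations and of the sine.
  The computation is done with complex exponentials, which factor over the coordinates.
\<close>

lemma std_gaussian_cos_transform:
  fixes u :: "real^'k"
  shows "(\<integral>x. cos (u \<bullet> x + \<theta>) \<partial>std_gaussian) = exp (- (u \<bullet> u) / 2) * cos \<theta>"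
proof -
  let ?B = "Basis :: (real^'k) set"
  interpret product_sigma_finite "\<lambda>_ :: real^'k. lborel :: real measure" by standard
  let ?f = "\<lambda>b t. of_real (std_normal_density t) * iexp ((u \<bullet> b) * t) :: complex"
  have f_int: "integrable lborel (?f b)" for b
  proof -
    have "integrable lborel (\<lambda>t. of_real (std_normal_density t) :: complex)" by simp
    then show ?thesis
      by (rule Bochner_Integration.integrable_bound) (auto simp: norm_mult)
  qed
  have f_val: "(\<integral>t. ?f b t \<partial>lborel) = of_real (exp (- (u \<bullet> b)\<^sup>2 / 2))" for b
  proof -
    have "char std_normal_distribution (u \<bullet> b) = (\<integral>t. ?f b t \<partial>lborel)"
      unfolding char_def by (subst integral_density) (auto simp: scaleR_conv_of_real)
    then show ?thesis by (simp add: char_std_normal_distribution)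
  qed
  have prod_eq: "(\<Prod>b\<in>?B. ?f b (x \<bullet> b)) = of_real (gauss_dens x) * iexp (u \<bullet> x)" for x
    by (simp add: prod.distrib gauss_dens_def prod_components_eq_prod_Basis euclidean_inner[of u x]
        sum_distrib_left exp_sum flip: exp_sum)
  have "(CLINT x|std_gaussian. iexp (u \<bullet> x)) = (\<integral>x. of_real (gauss_dens x) * iexp (u \<bullet> x) \<partial>lborel)"
    unfolding std_gaussian_eq by (subst integral_density) (auto simp: scaleR_conv_of_real gauss_dens_nonneg)
  also have "\<dots> = (\<integral>x. (\<Prod>b\<in>?B. ?f b (x \<bullet> b)) \<partial>lborel)" by (simp only: prod_eq)
  also have "\<dots> = (\<integral>y. (\<Prod>b\<in>?B. ?f b ((\<Sum>c\<in>?B. y c *\<^sub>R c) \<bullet> b)) \<partial>(\<Pi>\<^sub>M b\<in>?B. lborel))"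
    by (subst lborel_eq) (simp add: integral_distr)
  also have "\<dots> = (\<integral>y. (\<Prod>b\<in>?B. ?f b (y b)) \<partial>(\<Pi>\<^sub>M b\<in>?B. lborel))"
    by (simp cong: prod.cong)
  also have "\<dots> = (\<Prod>b\<in>?B. of_real (exp (- (u \<bullet> b)\<^sup>2 / 2)))"
    by (rule trans[OF product_integral_prod[OF finite_Basis f_int] prod.cong[OF refl f_val]])
  also have "\<dots> = of_real (exp (- (u \<bullet> u) / 2))"
  proof -
    have "(\<Prod>b\<in>?B. exp (- (u \<bullet> b)\<^sup>2 / 2)) = exp (\<Sum>b\<in>?B. - (u \<bullet> b)\<^sup>2 / 2)"
      by (simp add: exp_sum)
    also have "(\<Sum>b\<in>?B. - (u \<bullet> b)\<^sup>2 / 2) = - (u \<bullet> u) / 2"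
      by (simp add: euclidean_inner[of u u] power2_eq_square sum_negf sum_divide_distrib)
    finally show ?thesis unfolding of_real_prod[symmetric] by simp
  qed
  finally have C: "(CLINT x|std_gaussian. iexp (u \<bullet> x)) = of_real (exp (- (u \<bullet> u) / 2))" .
  have int: "integrable std_gaussian (\<lambda>x. iexp (u \<bullet> x))"
  proof -
    interpret prob_space "std_gaussian :: (real^'k) measure" using borel_probsD[OF std_gaussian_prob] by simp
    show ?thesis by (rule integrable_const_bound[where B=1]) auto
  qed
  have "(\<integral>x. cos (u \<bullet> x + \<theta>) \<partial>std_gaussian) = (\<integral>x. Re (iexp (u \<bullet> x) * cis \<theta>) \<partial>std_gaussian)"
    by (simp add: cos_add flip: cis_conv_exp)
  also have "\<dots> = Re (CLINT x|std_gaussian. iexp (u \<bullet> x) * cis \<theta>)"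
    using int by (intro integral_Re) auto
  also have "\<dots> = exp (- (u \<bullet> u) / 2) * cos \<theta>" using C int by simp
  finally show ?thesis .
qed

section \<open>The autoregressive kernel\<close>

lemma matrix_vector_mult_borel[measurable]: "(\<lambda>x. A *v x) \<in> borel_measurable borel"
  for A :: "real^'a^'b"
  by (intro borel_measurable_continuous_onI linear_continuous_on matrix_vector_mul_bounded_linear)

lemma ar_kernel_measurable: "ar_kernel M G \<in> borel \<rightarrow>\<^sub>M prob_algebra borel"
proof -
  have "(\<lambda>y. distr std_gaussian borel (\<lambda>x. M *v y + G *v x)) \<in> borel \<rightarrow>\<^sub>M subprob_algebra borel"
    using borel_probsD(1)[OF std_gaussian_prob] sets_std_gaussian
    by (intro measurable_distr2[where M=borel] measurable_const)
       (auto simp: space_subprob_algebra intro!: prob_space_imp_subprob_space)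
  moreover have "prob_space (ar_kernel M G y)" for y
    unfolding ar_kernel_def by (intro borel_probsD(1)[OF borel_probs_distr] std_gaussian_prob) auto
  ultimately show ?thesis
    by (intro measurable_prob_algebraI) (auto simp: ar_kernel_def[abs_def])
qed

lemma return_borel_probs: "return borel z \<in> borel_probs"
  by (simp add: space_prob_algebra prob_space_return)

lemma kernel_iter_0: "kernel_iter \<mu> Q 0 = \<mu>"
  and kernel_iter_Suc: "kernel_iter \<mu> Q (Suc n) = kernel_iter \<mu> Q n \<bind> Q"
  by (simp_all add: kernel_iter_def)

lemma kernel_iter_add: "kernel_iter \<mu> Q (m + n) = kernel_iter (kernel_iter \<mu> Q m) Q n"
  by (subst add.commute) (simp add: kernel_iter_def funpow_add)

lemma kernel_iter_probs:
  assumes "\<mu> \<in> borel_probs" "Q \<in> borel \<rightarrow>\<^sub>M prob_algebra borel"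
  shows "kernel_iter \<mu> Q n \<in> borel_probs"
  by (induction n) (auto simp: kernel_iter_0 kernel_iter_Suc assms borel_probs_bind)

lemma kernel_iter_measurable:
  assumes "Q \<in> borel \<rightarrow>\<^sub>M prob_algebra borel"
  shows "(\<lambda>y. kernel_iter (return borel y) Q n) \<in> borel \<rightarrow>\<^sub>M prob_algebra borel"
  by (induction n) (auto simp: kernel_iter_0 kernel_iter_Suc assms intro: measurable_bind_prob_space)

lemma kernel_iter_mixture:
  assumes "\<mu> \<in> borel_probs" "Q \<in> borel \<rightarrow>\<^sub>M prob_algebra borel"
  shows "kernel_iter \<mu> Q n = \<mu> \<bind> (\<lambda>y. kernel_iter (return borel y) Q n)"
proof (induction n)
  case 0
  then show ?case using bind_return''[of \<mu> borel] borel_probsD[OF assms(1)] by (simp add: kernel_iter_0)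
next
  case (Suc n)
  then show ?case
    using bind_assoc[OF kernel_measurable_on[OF assms(1) kernel_iter_measurable[OF assms(2)]]
       measurable_prob_algebraD[OF assms(2)]] by (simp add: kernel_iter_Suc)
qed

lemma ar_kernel_shift: "ar_kernel M G (a + y) = distr (ar_kernel M G y) borel ((+) (M *v a))"
  unfolding ar_kernel_def
  by (subst distr_distr) (auto simp: o_def matrix_vector_right_distrib add.assoc)

lemma bind_ar_kernel_shift:
  assumes \<mu>: "\<mu> \<in> borel_probs"
  shows "distr \<mu> borel ((+) a) \<bind> ar_kernel M G = distr (\<mu> \<bind> ar_kernel M G) borel ((+) (M *v a))"
proof -
  have ne: "space \<mu> \<noteq> {}" using borel_probsD[OF \<mu>] by simp
  have "distr \<mu> borel ((+) a) \<bind> ar_kernel M G = \<mu> \<bind> (\<lambda>y. ar_kernel M G (a + y))"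
    using measurable_prob_algebraD[OF ar_kernel_measurable] ne
    by (intro bind_distr) (auto simp: borel_probsD(4)[OF \<mu>])
  also have "\<dots> = distr (\<mu> \<bind> ar_kernel M G) borel ((+) (M *v a))"
    unfolding ar_kernel_shift
    by (rule distr_bind[OF kernel_measurable_on[OF \<mu> ar_kernel_measurable] ne, symmetric]) simp
  finally show ?thesis .
qed

lemma kernel_iter_shift:
  assumes \<mu>: "\<mu> \<in> borel_probs"
  shows "kernel_iter (distr \<mu> borel ((+) a)) (ar_kernel M G) n
       = distr (kernel_iter \<mu> (ar_kernel M G) n) borel ((+) (matpow M n *v a))"
  by (induction n)
     (simp_all add: kernel_iter_0 kernel_iter_Suc matpow_0 matpow_Suc
       bind_ar_kernel_shift[OF kernel_iter_probs[OF \<mu> ar_kernel_measurable]] flip: matrix_vector_mul_assoc)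

lemma kernel_iter_return_shift:
  "kernel_iter (return borel z) (ar_kernel M G) n
     = distr (kernel_iter (return borel y) (ar_kernel M G) n) borel ((+) (matpow M n *v (z - y)))"
proof -
  have "return borel z = distr (return borel y) borel ((+) (z - y))"
    by (subst distr_return) auto
  then show ?thesis by (simp add: kernel_iter_shift return_borel_probs)
qed

lemma distr_shift_shift:
  fixes a b :: "'a::euclidean_space"
  assumes "\<mu> \<in> borel_probs"
  shows "distr (distr \<mu> borel ((+) b)) borel ((+) a) = distr \<mu> borel ((+) (a + b))"
proof -
  have "(+) (a + b) = (+) a \<circ> (+) b" by (auto simp: add.assoc)
  then show ?thesis by (subst distr_distr) (auto simp: borel_probsD(4)[OF assms])
qed

text \<open>
  Translating the new state by G g amounts to translating the noise of this step by g.
\<close>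

lemma tv_dist_last_noise_shift:
  fixes G :: "real^'k^'n"
  assumes \<mu>: "\<mu> \<in> borel_probs"
  shows "tv_dist (\<mu> \<bind> ar_kernel M G) (distr (\<mu> \<bind> ar_kernel M G) borel ((+) (G *v g))) \<le> 3 / 2 * norm g"
proof -
  interpret prob_space \<mu> using borel_probsD[OF \<mu>] by simp
  have ne: "space \<mu> \<noteq> {}" using borel_probsD[OF \<mu>] by simp
  have eq: "distr (ar_kernel M G y) borel ((+) (G *v g))
      = distr (distr std_gaussian borel ((+) g)) borel (\<lambda>x. M *v y + G *v x)" for y
    unfolding ar_kernel_def
    by (subst (1 2) distr_distr) (auto simp: o_def matrix_vector_right_distrib algebra_simps)
  have "(\<lambda>y. distr (ar_kernel M G y) borel ((+) (G *v g))) \<in> borel \<rightarrow>\<^sub>M prob_algebra borel"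
    using ar_kernel_measurable by (intro measurable_distr_prob_space2[where M=borel]) auto
  moreover have "tv_dist (ar_kernel M G y) (distr (ar_kernel M G y) borel ((+) (G *v g))) \<le> 3 / 2 * norm g" for y
    unfolding eq unfolding ar_kernel_def
    by (intro order.trans[OF tv_dist_distr_le tv_dist_gaussian_shift] std_gaussian_prob borel_probs_distr) auto
  ultimately have "tv_dist (\<mu> \<bind> ar_kernel M G) (\<mu> \<bind> (\<lambda>y. distr (ar_kernel M G y) borel ((+) (G *v g))))
      \<le> (\<integral>y. 3 / 2 * norm g \<partial>\<mu>)"
    by (intro tv_dist_bind_kernels_le \<mu> ar_kernel_measurable) auto
  moreover have "\<mu> \<bind> (\<lambda>y. distr (ar_kernel M G y) borel ((+) (G *v g))) = distr (\<mu> \<bind> ar_kernel M G) borel ((+) (G *v g))"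
    by (rule distr_bind[OF kernel_measurable_on[OF \<mu> ar_kernel_measurable] ne, symmetric]) simp
  ultimately show ?thesis using prob_space by simp
qed

text \<open>
  Here g j displaces the noise that entered j steps before the end, so that its effect on the
  final state is M^j G (g j). The displacements are switched on one at a time, and each costs at most
  3/2 |g j| because later steps of the chain do not increase total variation.
\<close>

lemma tv_dist_noise_shift:
  fixes G :: "real^'k^'n"
  assumes \<mu>: "\<mu> \<in> borel_probs"
  shows "tv_dist (kernel_iter \<mu> (ar_kernel M G) n)
      (distr (kernel_iter \<mu> (ar_kernel M G) n) borel ((+) (\<Sum>j<n. matpow M j *v (G *v g j))))
     \<le> (\<Sum>j<n. 3 / 2 * norm (g j))"
proof (induction n arbitrary: g)
  case 0
  have "((+) (0 :: real^'n)) = (\<lambda>x. x)" by auto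
  then have "distr \<mu> borel ((+) 0) = \<mu>" using distr_id2[of borel \<mu>] borel_probsD(2)[OF \<mu>] by simp
  moreover have "tv_dist \<mu> \<mu> \<le> 0" by (rule tv_dist_least) simp
  ultimately show ?case by (simp only: kernel_iter_0 lessThan_0 sum.empty)
next
  case (Suc n)
  let ?\<nu> = "kernel_iter \<mu> (ar_kernel M G) n"
  define h where "h = (\<Sum>j<n. matpow M j *v (G *v g (Suc j)))"
  let ?T = "\<lambda>a \<kappa>. distr \<kappa> borel ((+) a)"
  have \<nu>: "?\<nu> \<in> borel_probs" by (intro kernel_iter_probs \<mu> ar_kernel_measurable)
  have \<nu>Q: "?\<nu> \<bind> ar_kernel M G \<in> borel_probs" by (intro borel_probs_bind \<nu> ar_kernel_measurable)
  have T: "?T a \<kappa> \<in> borel_probs" if "\<kappa> \<in> borel_probs" for a :: "real^'n" and \<kappa>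
    using that by (intro borel_probs_distr) auto
  have "(\<Sum>j<Suc n. matpow M j *v (G *v g j)) = G *v g 0 + M *v h"
    unfolding sum.lessThan_Suc_shift h_def
    by (simp add: matpow_0 matpow_Suc linear_sum[OF matrix_vector_mul_linear] flip: matrix_vector_mul_assoc)
  then have "?T (\<Sum>j<Suc n. matpow M j *v (G *v g j)) (?\<nu> \<bind> ar_kernel M G)
      = ?T (G *v g 0) (?T h ?\<nu> \<bind> ar_kernel M G)"
    unfolding bind_ar_kernel_shift[OF \<nu>] distr_shift_shift[OF \<nu>Q] by simp
  moreover have "tv_dist (?\<nu> \<bind> ar_kernel M G) (?T (G *v g 0) (?T h ?\<nu> \<bind> ar_kernel M G))
      \<le> tv_dist (?\<nu> \<bind> ar_kernel M G) (?T (G *v g 0) (?\<nu> \<bind> ar_kernel M G))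
        + tv_dist (?T (G *v g 0) (?\<nu> \<bind> ar_kernel M G)) (?T (G *v g 0) (?T h ?\<nu> \<bind> ar_kernel M G))"
    by (intro tv_dist_triangle T \<nu>Q borel_probs_bind ar_kernel_measurable \<nu>)
  moreover have "tv_dist (?\<nu> \<bind> ar_kernel M G) (?T (G *v g 0) (?\<nu> \<bind> ar_kernel M G)) \<le> 3 / 2 * norm (g 0)"
    by (rule tv_dist_last_noise_shift[OF \<nu>])
  moreover have "tv_dist (?T (G *v g 0) (?\<nu> \<bind> ar_kernel M G)) (?T (G *v g 0) (?T h ?\<nu> \<bind> ar_kernel M G))
      \<le> tv_dist ?\<nu> (?T h ?\<nu>)"
    by (intro order.trans[OF tv_dist_distr_le] tv_dist_bind_le T \<nu> borel_probs_bind ar_kernel_measurable) auto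
  moreover have "tv_dist ?\<nu> (?T h ?\<nu>) \<le> (\<Sum>j<n. 3 / 2 * norm (g (Suc j)))"
    unfolding h_def by (rule Suc.IH)
  ultimately show ?case by (simp only: kernel_iter_Suc sum.lessThan_Suc_shift)
qed

text \<open>
  The controls are g j = G^T (M^T)^j S h with S the inverse of the n-step covariance: by the
  definition of the covariance they sum up to h, and they are linear in h.
\<close>

lemma reachable_with_bounded_controls:
  fixes G :: "real^'k^'n"
  assumes "invertible (ar_cov M G n)"
  obtains K where "K \<ge> 0" "\<And>h. \<exists>g. (\<Sum>j<n. matpow M j *v (G *v g j)) = h \<and> (\<Sum>j<n. norm (g j)) \<le> K * norm h"
proof -
  obtain S where S: "ar_cov M G n ** S = mat 1" using assms unfolding invertible_def by blast
  define A where "A j = transpose G ** matpow (transpose M) j ** S" for j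
  define K where "K = (\<Sum>j<n. onorm ((*v) (A j)))"
  have A: "(\<Sum>j<n. matpow M j *v (G *v (A j *v h))) = h" for h
  proof -
    have "(\<Sum>j<n. matpow M j *v (G *v (A j *v h)))
        = (\<Sum>j<n. (matpow M j ** G ** transpose G ** matpow (transpose M) j) *v (S *v h))"
      by (simp add: A_def matrix_vector_mul_assoc matrix_mul_assoc)
    also have "\<dots> = ar_cov M G n *v (S *v h)"
      unfolding ar_cov_def
      by (rule linear_sum[OF linear_matrix_vector_left, symmetric])
    finally show ?thesis by (simp add: matrix_vector_mul_assoc S)
  qed
  have "(\<Sum>j<n. norm (A j *v h)) \<le> K * norm h" for h
    unfolding K_def sum_distrib_right by (intro sum_mono onorm matrix_vector_mul_bounded_linear)
  then have "\<exists>g. (\<Sum>j<n. matpow M j *v (G *v g j)) = h \<and> (\<Sum>j<n. norm (g j)) \<le> K * norm h" for h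
    using A[of h] by (intro exI[of _ "\<lambda>j. A j *v h"]) simp
  moreover have "K \<ge> 0" unfolding K_def by (intro sum_nonneg onorm_pos_le matrix_vector_mul_bounded_linear)
  ultimately show ?thesis using that by simp
qed

text \<open>
  The n-step laws from z and y differ by the displacement M^n (z - y), and the last n0 noise
  vectors can produce this displacement at a proportional cost.
\<close>

lemma tv_dist_starting_points:
  fixes G :: "real^'k^'n"
  assumes "invertible (ar_cov M G n0)"
  obtains K where "K \<ge> 0"
    "\<And>n z y. n \<ge> n0 \<Longrightarrow> tv_dist (kernel_iter (return borel z) (ar_kernel M G) n)
       (kernel_iter (return borel y) (ar_kernel M G) n) \<le> K * norm (matpow M n *v (z - y))"
proof -
  obtain K where K: "K \<ge> 0"
    "\<And>h. \<exists>g. (\<Sum>j<n0. matpow M j *v (G *v g j)) = h \<and> (\<Sum>j<n0. norm (g j)) \<le> K * norm h"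
    using reachable_with_bounded_controls[OF assms] by blast
  have "tv_dist (kernel_iter (return borel z) (ar_kernel M G) n)
       (kernel_iter (return borel y) (ar_kernel M G) n) \<le> 3 / 2 * K * norm (matpow M n *v (z - y))"
    if n: "n \<ge> n0" for n z y
  proof -
    let ?h = "matpow M n *v (z - y)"
    let ?\<mu> = "kernel_iter (return borel y) (ar_kernel M G) (n - n0)"
    have \<mu>: "?\<mu> \<in> borel_probs" by (intro kernel_iter_probs return_borel_probs ar_kernel_measurable)
    obtain g where g: "(\<Sum>j<n0. matpow M j *v (G *v g j)) = ?h" "(\<Sum>j<n0. norm (g j)) \<le> K * norm ?h"
      using K(2) by blast
    have y: "kernel_iter (return borel y) (ar_kernel M G) n = kernel_iter ?\<mu> (ar_kernel M G) n0"
      using n by (simp flip: kernel_iter_add)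
    have "tv_dist (kernel_iter (return borel y) (ar_kernel M G) n)
       (kernel_iter (return borel z) (ar_kernel M G) n) \<le> (\<Sum>j<n0. 3 / 2 * norm (g j))"
      unfolding kernel_iter_return_shift[of z M G n y] y g(1)[symmetric] by (rule tv_dist_noise_shift[OF \<mu>])
    also have "\<dots> = 3 / 2 * (\<Sum>j<n0. norm (g j))" by (rule sum_distrib_left[symmetric])
    also have "\<dots> \<le> 3 / 2 * K * norm ?h" using g(2) by simp
    finally show ?thesis by (subst tv_dist_commute)
  qed
  then show ?thesis using that[of "3 / 2 * K"] K(1) by simp
qed

text \<open>
  The variance of u \<bullet> x under the n-step transition law, that is, the quadratic form of the
  covariance matrix at u.
\<close>

definition ar_var :: "real^'n^'n \<Rightarrow> real^'k^'n \<Rightarrow> nat \<Rightarrow> real^'n \<Rightarrow> real" where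
  "ar_var M G n u = (\<Sum>j<n. (norm (transpose G *v (matpow (transpose M) j *v u)))\<^sup>2)"

lemma inner_matrix_vector: "u \<bullet> (A *v x) = (transpose A *v u) \<bullet> x" for A :: "real^'a^'b"
  by (metis dot_lmul_matrix transpose_matrix_vector)

text \<open>
  Integrating out the noise of the last step leaves the same kind of integral with u replaced by
  M^T u, which is why the induction is over all u and \<theta>.
\<close>

lemma cos_transform_kernel_iter:
  fixes G :: "real^'k^'n"
  shows "(\<integral>x. cos (u \<bullet> x + \<theta>) \<partial>kernel_iter (return borel 0) (ar_kernel M G) n)
       = exp (- ar_var M G n u / 2) * cos \<theta>"
proof (induction n arbitrary: u \<theta>)
  case 0
  show ?case by (simp add: kernel_iter_0 ar_var_def integral_return)
next
  case (Suc n)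
  let ?W = "kernel_iter (return borel 0) (ar_kernel M G) n"
  have W: "?W \<in> borel_probs" by (intro kernel_iter_probs return_borel_probs ar_kernel_measurable)
  have "(\<integral>x. cos (u \<bullet> x + \<theta>) \<partial>(?W \<bind> ar_kernel M G))
      = (\<integral>y. \<integral>x. cos (u \<bullet> x + \<theta>) \<partial>ar_kernel M G y \<partial>?W)"
  proof (rule integral_bind[where B=1 and B'=1 and K=borel])
    show "finite_measure ?W" using borel_probsD(1)[OF W] by (simp add: prob_space_def)
    show "AE y in ?W. emeasure (ar_kernel M G y) (space (ar_kernel M G y)) \<le> ennreal 1"
      by (simp add: prob_space.emeasure_space_1[OF borel_probsD(1)[OF borel_probs_kernel[OF ar_kernel_measurable]]])
  qed (auto intro: kernel_measurable_on[OF W ar_kernel_measurable])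
  also have "\<dots> = (\<integral>y. exp (- (norm (transpose G *v u))\<^sup>2 / 2) * cos ((transpose M *v u) \<bullet> y + \<theta>) \<partial>?W)"
  proof (rule Bochner_Integration.integral_cong[OF refl])
    fix y
    have "(\<integral>x. cos (u \<bullet> x + \<theta>) \<partial>ar_kernel M G y)
        = (\<integral>x. cos ((transpose G *v u) \<bullet> x + ((transpose M *v u) \<bullet> y + \<theta>)) \<partial>std_gaussian)"
      unfolding ar_kernel_def
      by (subst integral_distr) (auto simp: inner_add_right inner_matrix_vector algebra_simps)
    then show "(\<integral>x. cos (u \<bullet> x + \<theta>) \<partial>ar_kernel M G y)
        = exp (- (norm (transpose G *v u))\<^sup>2 / 2) * cos ((transpose M *v u) \<bullet> y + \<theta>)"
      by (simp only: std_gaussian_cos_transform power2_norm_eq_inner)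
  qed
  also have "\<dots> = exp (- (norm (transpose G *v u))\<^sup>2 / 2) * (exp (- ar_var M G n (transpose M *v u) / 2) * cos \<theta>)"
    using Suc.IH[of "transpose M *v u"] by simp
  also have "\<dots> = exp (- ar_var M G (Suc n) u / 2) * cos \<theta>"
    unfolding ar_var_def sum.lessThan_Suc_shift
    by (simp add: matpow_0 matpow_Suc_right exp_add[symmetric] algebra_simps flip: matrix_vector_mul_assoc mult.assoc)
  finally show ?case by (simp add: kernel_iter_Suc)
qed

text \<open>
  The powers of the transpose obey the same geometric bound as those of M, and a geometric series
  is summed.
\<close>

lemma ar_var_bounded:
  fixes M :: "real^'n^'n" and G :: "real^'k^'n"
  assumes "spectral_radius M < 1"
  obtains B where "\<And>n u. ar_var M G n u \<le> B * (norm u)\<^sup>2"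
proof -
  obtain r where r: "spectral_radius M < r" "r < 1" using dense[OF assms] by blast
  have r0: "0 < r" using r spectral_radius_nonneg[of M] by linarith
  obtain C where C: "C \<ge> 0" "\<And>n x. norm (matpow M n *v x) \<le> C * r ^ n * norm x"
    using matpow_growth[OF r(1)] by blast
  have adj: "norm (transpose (matpow M n) *v u) \<le> C * r ^ n * norm u" for n u
  proof -
    let ?w = "transpose (matpow M n) *v u"
    (* The transpose inherits the bound by testing against its own image. *)
    have "norm ?w * norm ?w = u \<bullet> (matpow M n *v ?w)"
      by (simp add: inner_matrix_vector flip: power2_norm_eq_inner power2_eq_square)
    also have "\<dots> \<le> norm u * (C * r ^ n * norm ?w)"
      by (rule order.trans[OF norm_cauchy_schwarz mult_left_mono[OF C(2)]]) auto
    finally have "norm ?w * norm ?w \<le> (C * r ^ n * norm u) * norm ?w" by (simp add: mult_ac)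
    then show ?thesis
    proof (cases "?w = 0")
      case True
      then show ?thesis using C(1) r0 by simp
    next
      case False
      then have "0 < norm ?w" by simp
      with \<open>norm ?w * norm ?w \<le> _\<close> show ?thesis by (rule mult_right_le_imp_le)
    qed
  qed
  define D where "D = onorm ((*v) (transpose G))"
  have D: "D \<ge> 0" "\<And>x. norm (transpose G *v x) \<le> D * norm x"
    unfolding D_def by (intro onorm onorm_pos_le matrix_vector_mul_bounded_linear)+
  have r2: "r\<^sup>2 < 1" using r r0 by (simp add: power_less_one_iff abs_square_less_1)
  have "ar_var M G n u \<le> (D * C)\<^sup>2 / (1 - r\<^sup>2) * (norm u)\<^sup>2" for n u
  proof -
    have "ar_var M G n u \<le> (\<Sum>j<n. (D * (C * r ^ j * norm u))\<^sup>2)"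
      unfolding ar_var_def matpow_transpose
      by (intro sum_mono power_mono order.trans[OF D(2) mult_left_mono[OF adj D(1)]]) auto
    also have "\<dots> = (D * C)\<^sup>2 * (norm u)\<^sup>2 * (\<Sum>j<n. (r\<^sup>2) ^ j)"
      by (simp add: sum_distrib_left power_mult_distrib mult_ac flip: power_mult)
    also have "\<dots> \<le> (D * C)\<^sup>2 * (norm u)\<^sup>2 * (1 / (1 - r\<^sup>2))"
    proof -
      have "(\<Sum>j<n. (r\<^sup>2) ^ j) \<le> (\<Sum>j. (r\<^sup>2) ^ j)"
        using r2 by (intro sum_le_suminf summable_geometric) auto
      then show ?thesis using r2 by (intro mult_left_mono) (simp_all add: suminf_geometric)
    qed
    finally show ?thesis by simp
  qed
  then show ?thesis using that by blast
qed

section \<open>The limit law\<close>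

lemma tv_dist_tendsto_measure:
  assumes \<mu>: "\<And>n. \<mu> n \<in> borel_probs" and \<pi>: "\<pi> \<in> borel_probs"
    and lim: "(\<lambda>n. tv_dist (\<mu> n) \<pi>) \<longlonglongrightarrow> 0" and A: "A \<in> sets borel"
  shows "(\<lambda>n. measure (\<mu> n) A) \<longlonglongrightarrow> measure \<pi> A"
proof -
  have "(\<lambda>n. measure (\<mu> n) A - measure \<pi> A) \<longlonglongrightarrow> 0"
    using lim tv_dist_upper[OF \<mu> \<pi> A] by (intro Lim_null_comparison[OF _ lim]) auto
  then show ?thesis using LIM_zero_iff by blast
qed

lemma tv_dist_eq_0_imp_eq:
  assumes \<mu>: "\<mu> \<in> borel_probs" and \<nu>: "\<nu> \<in> borel_probs" and "tv_dist \<mu> \<nu> \<le> 0"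
  shows "\<mu> = \<nu>"
proof (rule measure_eqI)
  interpret \<mu>: prob_space \<mu> using borel_probsD[OF \<mu>] by simp
  interpret \<nu>: prob_space \<nu> using borel_probsD[OF \<nu>] by simp
  show "sets \<mu> = sets \<nu>" using borel_probsD[OF \<mu>] borel_probsD[OF \<nu>] by simp
  fix A assume "A \<in> sets \<mu>"
  then have "\<bar>measure \<mu> A - measure \<nu> A\<bar> \<le> 0"
    using tv_dist_upper[OF \<mu> \<nu>, of A] assms(3) borel_probsD[OF \<mu>] by simp
  then show "emeasure \<mu> A = emeasure \<nu> A"
    by (simp add: \<mu>.emeasure_eq_measure \<nu>.emeasure_eq_measure)
qed

text \<open>
  The candidate limit assigns to A the limit of the numbers \<mu> n A. Convergence is uniform in A, and
  this is what makes the limit continuous at the empty set, hence countably additive.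
\<close>

lemma tv_dist_complete:
  fixes \<mu> :: "nat \<Rightarrow> 'a::topological_space measure"
  assumes \<mu>: "\<And>n. \<mu> n \<in> borel_probs" and \<epsilon>: "\<epsilon> \<longlonglongrightarrow> 0"
    and cauchy: "\<And>n m. n \<ge> n0 \<Longrightarrow> tv_dist (\<mu> n) (\<mu> (n + m)) \<le> \<epsilon> n"
  obtains \<pi> where "\<pi> \<in> borel_probs" "(\<lambda>n. tv_dist (\<mu> n) \<pi>) \<longlonglongrightarrow> 0"
proof -
  define L where "L A = lim (\<lambda>n. measure (\<mu> n) A)" for A
  have diff: "\<bar>measure (\<mu> n) A - measure (\<mu> (n + m)) A\<bar> \<le> \<epsilon> n" if "n \<ge> n0" "A \<in> sets borel" for n m A
    using tv_dist_upper[OF \<mu>[of n] \<mu>[of "n + m"] that(2)] cauchy[OF that(1), of m] by linarith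
  have L: "(\<lambda>n. measure (\<mu> n) A) \<longlonglongrightarrow> L A" if A: "A \<in> sets borel" for A
  proof -
    have "Cauchy (\<lambda>n. measure (\<mu> n) A)"
    proof (rule metric_CauchyI)
      fix e :: real assume "0 < e"
      then have "eventually (\<lambda>n. \<epsilon> n < e / 2) sequentially" by (intro order_tendstoD(2)[OF \<epsilon>]) auto
      then obtain N where N: "N \<ge> n0" "\<epsilon> N < e / 2"
        unfolding eventually_sequentially by (metis max.cobounded1 max.cobounded2)
      have *: "\<bar>measure (\<mu> N) A - measure (\<mu> n) A\<bar> < e / 2" if "n \<ge> N" for n
        using diff[OF N(1) A, of "n - N"] N(2) that by simp
      show "\<exists>M. \<forall>m\<ge>M. \<forall>n\<ge>M. dist (measure (\<mu> m) A) (measure (\<mu> n) A) < e"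
      proof (intro exI[of _ N] allI impI)
        fix m n assume "m \<ge> N" "n \<ge> N"
        then show "dist (measure (\<mu> m) A) (measure (\<mu> n) A) < e"
          using *[of m] *[of n] unfolding dist_real_def by linarith
      qed
    qed
    then show ?thesis by (simp add: L_def Cauchy_convergent_iff convergent_LIMSEQ_iff)
  qed
  have close: "\<bar>measure (\<mu> n) A - L A\<bar> \<le> \<epsilon> n" if "n \<ge> n0" "A \<in> sets borel" for n A
  proof -
    have "(\<lambda>m. measure (\<mu> (n + m)) A) \<longlonglongrightarrow> L A"
      using LIMSEQ_ignore_initial_segment[OF L[OF that(2)], of n] by (simp add: add.commute)
    then have "(\<lambda>m. \<bar>measure (\<mu> n) A - measure (\<mu> (n + m)) A\<bar>) \<longlonglongrightarrow> \<bar>measure (\<mu> n) A - L A\<bar>"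
      by (intro tendsto_intros)
    then show ?thesis using diff[OF that] by (intro LIMSEQ_le_const2) auto
  qed
  have L0: "0 \<le> L A" if "A \<in> sets borel" for A
    by (rule LIMSEQ_le_const[OF L[OF that]]) auto
  have Lempty: "L {} = 0" using LIMSEQ_unique[OF L[of "{}"], of 0] by simp
  have Ladd: "L (A \<union> B) = L A + L B" if "A \<in> sets borel" "B \<in> sets borel" "A \<inter> B = {}" for A B
  proof -
    have "measure (\<mu> n) (A \<union> B) = measure (\<mu> n) A + measure (\<mu> n) B" for n
    proof -
      interpret prob_space "\<mu> n" using borel_probsD[OF \<mu>] by simp
      show ?thesis using that by (intro finite_measure_Union) (auto simp: borel_probsD(2)[OF \<mu>])
    qed
    then show ?thesis
      using LIMSEQ_unique[OF L[of "A \<union> B"]] tendsto_add[OF L[OF that(1)] L[OF that(2)]] that by simp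
  qed
  have cont: "(\<lambda>i. L (A i)) \<longlonglongrightarrow> 0"
    if A: "range A \<subseteq> sets borel" "decseq A" "(\<Inter>i. A i) = {}" for A :: "nat \<Rightarrow> 'a set"
  proof (rule LIMSEQ_I)
    fix e :: real assume e: "0 < e"
    then have "eventually (\<lambda>n. \<epsilon> n < e / 2) sequentially" by (intro order_tendstoD(2)[OF \<epsilon>]) auto
    then obtain N where N: "N \<ge> n0" "\<epsilon> N < e / 2"
      unfolding eventually_sequentially by (metis max.cobounded1 max.cobounded2)
    interpret prob_space "\<mu> N" using borel_probsD[OF \<mu>] by simp
    have "(\<lambda>i. measure (\<mu> N) (A i)) \<longlonglongrightarrow> measure (\<mu> N) (\<Inter>i. A i)"
      using A by (intro finite_Lim_measure_decseq) (auto simp: borel_probsD(2)[OF \<mu>])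
    then have "(\<lambda>i. measure (\<mu> N) (A i)) \<longlonglongrightarrow> 0" using A(3) by simp
    then have "eventually (\<lambda>i. measure (\<mu> N) (A i) < e / 2) sequentially"
      using e by (intro order_tendstoD(2)) auto
    then obtain I where I: "\<And>i. i \<ge> I \<Longrightarrow> measure (\<mu> N) (A i) < e / 2"
      unfolding eventually_sequentially by blast
    show "\<exists>no. \<forall>n\<ge>no. norm (L (A n) - 0) < e"
    proof (intro exI[of _ I] allI impI)
      fix i assume "i \<ge> I"
      moreover have "A i \<in> sets borel" using A by auto
      ultimately show "norm (L (A i) - 0) < e"
        using I[of i] close[OF N(1), of "A i"] N(2) L0[of "A i"] by simp
    qed
  qed
  define \<pi> where "\<pi> = measure_of UNIV (sets (borel :: 'a measure)) (\<lambda>A. ennreal (L A))"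
  interpret borel: sigma_algebra UNIV "sets (borel :: 'a measure)"
    using sets.sigma_algebra_axioms[of "borel :: 'a measure"] by simp
  have pos: "positive (sets (borel :: 'a measure)) (\<lambda>A. ennreal (L A))"
    by (simp add: positive_def Lempty)
  have add: "additive (sets (borel :: 'a measure)) (\<lambda>A. ennreal (L A))"
    by (simp add: additive_def Ladd L0)
  have "countably_additive (sets (borel :: 'a measure)) (\<lambda>A. ennreal (L A))"
  proof (rule borel.empty_continuous_imp_countably_additive[OF pos add])
    fix A :: "nat \<Rightarrow> 'a set"
    assume "range A \<subseteq> sets borel" "decseq A" "(\<Inter>i. A i) = {}"
    then show "(\<lambda>i. ennreal (L (A i))) \<longlonglongrightarrow> 0" using tendsto_ennrealI[OF cont[of A]] by simp
  qed simp
  then have em: "emeasure \<pi> A = ennreal (L A)" if "A \<in> sets borel" for A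
    unfolding \<pi>_def using pos that by (intro emeasure_measure_of_sigma borel.sigma_algebra_axioms)
  have sets_\<pi>: "sets \<pi> = sets borel" unfolding \<pi>_def by (simp add: borel.sigma_sets_eq)
  have m: "measure \<pi> A = L A" if "A \<in> sets borel" for A
    using em[OF that] L0[OF that] by (simp add: measure_def)
  have "L UNIV = 1"
  proof -
    have "measure (\<mu> n) UNIV = 1" for n
      using prob_space.prob_space[OF borel_probsD(1)[OF \<mu>]] borel_probsD(3)[OF \<mu>] by metis
    then show ?thesis using LIMSEQ_unique[OF L[of UNIV], of 1] by simp
  qed
  moreover have "space \<pi> = UNIV" using sets_eq_imp_space_eq[OF sets_\<pi>] by simp
  ultimately have "prob_space \<pi>" by (intro prob_spaceI) (simp add: em)
  then have \<pi>: "\<pi> \<in> borel_probs" using sets_\<pi> by (simp add: space_prob_algebra)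
  have "tv_dist (\<mu> n) \<pi> \<le> \<epsilon> n" if "n \<ge> n0" for n
    using close[OF that] m by (intro tv_dist_least) simp
  then have "(\<lambda>n. tv_dist (\<mu> n) \<pi>) \<longlonglongrightarrow> 0"
    using tv_dist_nonneg[OF \<mu> \<pi>]
    by (intro Lim_null_comparison[OF _ \<epsilon>]) (auto simp: eventually_sequentially)
  with \<pi> that show ?thesis by blast
qed

lemma tv_dist_starting_points_geometric:
  fixes M :: "real^'n^'n" and G :: "real^'k^'n"
  assumes inv: "invertible (ar_cov M G n0)" and r: "spectral_radius M < r"
  shows "\<exists>C\<ge>0. \<forall>n\<ge>n0. tv_dist (kernel_iter (return borel z) (ar_kernel M G) n)
           (kernel_iter (return borel y) (ar_kernel M G) n) \<le> C * r ^ n"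
proof -
  let ?P = "\<lambda>z. kernel_iter (return borel z) (ar_kernel M G)"
  obtain K where K: "K \<ge> 0"
    "\<And>n z y. n \<ge> n0 \<Longrightarrow> tv_dist (?P z n) (?P y n) \<le> K * norm (matpow M n *v (z - y))"
    using tv_dist_starting_points[OF inv] by blast
  obtain B where B: "B \<ge> 0" "\<And>n x. norm (matpow M n *v x) \<le> B * r ^ n * norm x"
    using matpow_growth[OF r] by blast
  have "tv_dist (?P z n) (?P y n) \<le> K * B * norm (z - y) * r ^ n" if "n \<ge> n0" for n
    using order.trans[OF K(2)[OF that] mult_left_mono[OF B(2) K(1)]] by (simp add: mult_ac)
  then show ?thesis using K(1) B(1) by (intro exI[of _ "K * B * norm (z - y)"]) auto
qed

text \<open>
  W(n + 1) is the mixture over y of the n-step laws from y, with y distributed as W(1). So its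
  distance to W(n) is at most the average of K |M^n y|, which is O(r^n) because W(1) has a finite
  first moment. The steps form a geometric series.
\<close>

lemma tv_dist_successive_laws:
  fixes M :: "real^'n^'n" and G :: "real^'k^'n"
  assumes inv: "invertible (ar_cov M G n0)" and r: "spectral_radius M < r" "r < 1"
  shows "\<exists>C\<ge>0. \<forall>n\<ge>n0. \<forall>m. tv_dist (kernel_iter (return borel 0) (ar_kernel M G) n)
             (kernel_iter (return borel 0) (ar_kernel M G) (n + m)) \<le> C * r ^ n"
proof -
  let ?Q = "ar_kernel M G"
  let ?W = "kernel_iter (return borel 0) ?Q"
  have r0: "0 < r" using r spectral_radius_nonneg[of M] by linarith
  have W: "?W n \<in> borel_probs" for n by (intro kernel_iter_probs return_borel_probs ar_kernel_measurable)
  obtain K where K: "K \<ge> 0"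
    "\<And>n z y. n \<ge> n0 \<Longrightarrow> tv_dist (kernel_iter (return borel z) ?Q n)
       (kernel_iter (return borel y) ?Q n) \<le> K * norm (matpow M n *v (z - y))"
    using tv_dist_starting_points[OF inv] by blast
  obtain C where C: "C \<ge> 0" "\<And>n x. norm (matpow M n *v x) \<le> C * r ^ n * norm x"
    using matpow_growth[OF r(1)] by blast
  define E where "E = (\<integral>y. norm y \<partial>?W 1)"
  have W1: "?W 1 = distr std_gaussian borel (\<lambda>x. G *v x)"
    using bind_return[OF measurable_prob_algebraD[OF ar_kernel_measurable], of 0 M G]
    by (simp add: kernel_iter_def ar_kernel_def[of M G 0])
  have int: "integrable (?W 1) norm"
    unfolding W1 using std_gaussian_norm_integrable[of G]
    by (subst integrable_distr_eq) (auto simp: measurable_cong_sets[OF sets_std_gaussian refl])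
  have E0: "E \<ge> 0" unfolding E_def by simp
  define D where "D = K * C * E"
  have D: "D \<ge> 0" unfolding D_def using K C E0 by simp
  have step: "tv_dist (?W n) (?W (Suc n)) \<le> D * r ^ n" if n: "n \<ge> n0" for n
  proof -
    have "?W (Suc n) = ?W 1 \<bind> (\<lambda>y. kernel_iter (return borel y) ?Q n)"
      by (subst kernel_iter_mixture[OF W[of 1] ar_kernel_measurable, symmetric])
         (simp flip: kernel_iter_add)
    moreover have "tv_dist (?W n) (?W 1 \<bind> (\<lambda>y. kernel_iter (return borel y) ?Q n))
        \<le> (\<integral>y. K * C * r ^ n * norm y \<partial>?W 1)"
    proof (rule tv_dist_mixture_le[OF W W kernel_iter_measurable[OF ar_kernel_measurable]])
      fix y
      have "tv_dist (?W n) (kernel_iter (return borel y) ?Q n) \<le> K * norm (matpow M n *v (0 - y))"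
        by (rule K(2)[OF n])
      also have "\<dots> \<le> K * (C * r ^ n * norm (0 - y))" by (intro mult_left_mono C K)
      finally show "tv_dist (?W n) (kernel_iter (return borel y) ?Q n) \<le> K * C * r ^ n * norm y"
        by (simp add: mult_ac)
    qed (use int in simp)
    ultimately show ?thesis by (simp add: D_def E_def mult_ac)
  qed
  have sum_bound: "(\<Sum>j<m. r ^ j) \<le> 1 / (1 - r)" for m
  proof -
    have "(\<Sum>j<m. r ^ j) \<le> (\<Sum>j. r ^ j)"
      using r r0 by (intro sum_le_suminf summable_geometric) auto
    then show ?thesis using r r0 by (simp add: suminf_geometric)
  qed
  have "tv_dist (?W n) (?W (n + m)) \<le> D * r ^ n * (\<Sum>j<m. r ^ j)" if n: "n \<ge> n0" for n m
  proof (induction m)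
    case 0
    show ?case using tv_dist_least[of "?W n" "?W n" 0] by simp
  next
    case (Suc m)
    have "tv_dist (?W n) (?W (n + Suc m)) \<le> tv_dist (?W n) (?W (n + m)) + tv_dist (?W (n + m)) (?W (Suc (n + m)))"
      using tv_dist_triangle[OF W W W] by simp
    also have "\<dots> \<le> D * r ^ n * (\<Sum>j<m. r ^ j) + D * r ^ (n + m)"
      using n by (intro add_mono Suc step) simp
    finally show ?case by (simp add: algebra_simps power_add)
  qed
  then have "tv_dist (?W n) (?W (n + m)) \<le> D / (1 - r) * r ^ n" if n: "n \<ge> n0" for n m
  proof -
    have "D * r ^ n * (\<Sum>j<m. r ^ j) \<le> D * r ^ n * (1 / (1 - r))"
      using sum_bound D r0 by (intro mult_left_mono) auto
    with \<open>\<And>n m. n \<ge> n0 \<Longrightarrow> tv_dist (?W n) (?W (n + m)) \<le> _ n m\<close>[OF n, of m]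
    show ?thesis by simp
  qed
  then show ?thesis using D r by (intro exI[of _ "D / (1 - r)"]) auto
qed

text \<open>
  One rate s serves to construct the limit; the bound for every other rate r then comes from letting
  m tend to infinity in the estimate for W(n) and W(n + m).
\<close>

lemma geometric_convergence_to_limit_law:
  fixes M :: "real^'n^'n" and G :: "real^'k^'n"
  assumes inv: "invertible (ar_cov M G n0)" and \<rho>: "spectral_radius M < 1"
  obtains \<pi> where "\<pi> \<in> borel_probs"
    "\<And>r z. spectral_radius M < r \<Longrightarrow> r < 1 \<Longrightarrow>
      \<exists>C\<ge>0. \<forall>n\<ge>n0. tv_dist (kernel_iter (return borel z) (ar_kernel M G) n) \<pi> \<le> C * r ^ n"
proof -
  let ?Q = "ar_kernel M G"
  let ?P = "\<lambda>z. kernel_iter (return borel z) ?Q"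
  have P: "?P z n \<in> borel_probs" for z n by (intro kernel_iter_probs return_borel_probs ar_kernel_measurable)
  obtain s where s: "spectral_radius M < s" "s < 1" using dense[OF \<rho>] by blast
  then have s0: "0 < s" using spectral_radius_nonneg[of M] by linarith
  obtain C where C: "\<And>n m. n \<ge> n0 \<Longrightarrow> tv_dist (?P 0 n) (?P 0 (n + m)) \<le> C * s ^ n"
    using tv_dist_successive_laws[OF inv s] by blast
  have "(\<lambda>n. C * s ^ n) \<longlonglongrightarrow> C * 0"
    using s s0 by (intro tendsto_intros LIMSEQ_realpow_zero) auto
  then have "(\<lambda>n. C * s ^ n) \<longlonglongrightarrow> 0" by simp
  then obtain \<pi> where \<pi>: "\<pi> \<in> borel_probs" and lim: "(\<lambda>n. tv_dist (?P 0 n) \<pi>) \<longlonglongrightarrow> 0"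
    using tv_dist_complete[of "?P 0" "\<lambda>n. C * s ^ n" n0] P C by blast
  have "\<exists>C\<ge>0. \<forall>n\<ge>n0. tv_dist (?P z n) \<pi> \<le> C * r ^ n"
    if r: "spectral_radius M < r" "r < 1" for r z
  proof -
    obtain C1 where C1: "C1 \<ge> 0" "\<And>n. n \<ge> n0 \<Longrightarrow> tv_dist (?P z n) (?P 0 n) \<le> C1 * r ^ n"
      using tv_dist_starting_points_geometric[OF inv r(1)] by blast
    obtain C2 where C2: "C2 \<ge> 0" "\<And>n m. n \<ge> n0 \<Longrightarrow> tv_dist (?P 0 n) (?P 0 (n + m)) \<le> C2 * r ^ n"
      using tv_dist_successive_laws[OF inv r] by blast
    have "tv_dist (?P z n) \<pi> \<le> (C1 + C2) * r ^ n" if n: "n \<ge> n0" for n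
    proof -
      have "(\<lambda>m. tv_dist (?P 0 (n + m)) \<pi>) \<longlonglongrightarrow> 0"
        using LIMSEQ_ignore_initial_segment[OF lim, of n] by (simp add: add.commute)
      then have "(\<lambda>m. C2 * r ^ n + tv_dist (?P 0 (n + m)) \<pi>) \<longlonglongrightarrow> C2 * r ^ n + 0"
        by (intro tendsto_intros)
      moreover have "tv_dist (?P 0 n) \<pi> \<le> C2 * r ^ n + tv_dist (?P 0 (n + m)) \<pi>" for m
        using tv_dist_triangle[OF P P \<pi>] C2(2)[OF n, of m] by (smt (verit))
      ultimately have "tv_dist (?P 0 n) \<pi> \<le> C2 * r ^ n + 0"
        by (intro LIMSEQ_le_const[where X = "\<lambda>m. C2 * r ^ n + tv_dist (?P 0 (n + m)) \<pi>"]) auto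
      moreover have "tv_dist (?P z n) \<pi> \<le> tv_dist (?P z n) (?P 0 n) + tv_dist (?P 0 n) \<pi>"
        by (intro tv_dist_triangle P \<pi>)
      ultimately show ?thesis using C1(2)[OF n] by (simp add: algebra_simps)
    qed
    then show ?thesis using C1(1) C2(1) by (intro exI[of _ "C1 + C2"]) auto
  qed
  then show ?thesis using that \<pi> by blast
qed

lemma tendsto_zero_of_geometric_bound:
  fixes a :: "nat \<Rightarrow> real"
  assumes "\<And>n. 0 \<le> a n" "\<And>n. n \<ge> n0 \<Longrightarrow> a n \<le> C * r ^ n" "0 \<le> r" "r < 1"
  shows "a \<longlonglongrightarrow> 0"
proof -
  have "(\<lambda>n. C * r ^ n) \<longlonglongrightarrow> C * 0"
    using assms by (intro tendsto_intros LIMSEQ_realpow_zero) auto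
  then have "(\<lambda>n. C * r ^ n) \<longlonglongrightarrow> 0" by simp
  then show ?thesis
    by (rule Lim_null_comparison[rotated]) (use assms in \<open>auto simp: eventually_sequentially\<close>)
qed

text \<open>
  Applying Q to the n-step law gives the next law in the sequence and does not increase its distance
  to the limit.
\<close>

lemma limit_law_invariant:
  assumes Q: "Q \<in> borel \<rightarrow>\<^sub>M prob_algebra borel" and \<pi>: "\<pi> \<in> borel_probs"
    and lim: "(\<lambda>n. tv_dist (kernel_iter (return borel z) Q n) \<pi>) \<longlonglongrightarrow> 0"
  shows "invariant_law Q \<pi>"
proof -
  let ?P = "kernel_iter (return borel z) Q"
  have P: "?P n \<in> borel_probs" for n by (intro kernel_iter_probs return_borel_probs Q)
  have \<pi>Q: "\<pi> \<bind> Q \<in> borel_probs" by (intro borel_probs_bind \<pi> Q)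
  have "tv_dist \<pi> (\<pi> \<bind> Q) \<le> tv_dist (?P (Suc n)) \<pi> + tv_dist (?P n) \<pi>" for n
    using tv_dist_triangle[OF \<pi> P[of "Suc n"] \<pi>Q] tv_dist_bind_le[OF P[of n] \<pi> Q]
    by (simp add: kernel_iter_Suc tv_dist_commute[of \<pi>])
  moreover have "(\<lambda>n. tv_dist (?P (Suc n)) \<pi> + tv_dist (?P n) \<pi>) \<longlonglongrightarrow> 0 + 0"
    by (intro tendsto_add lim LIMSEQ_Suc)
  ultimately have "tv_dist \<pi> (\<pi> \<bind> Q) \<le> 0 + 0"
    by (intro LIMSEQ_le_const[where X = "\<lambda>n. tv_dist (?P (Suc n)) \<pi> + tv_dist (?P n) \<pi>"]) auto
  then have "\<pi> = \<pi> \<bind> Q" using tv_dist_eq_0_imp_eq[OF \<pi> \<pi>Q] by simp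
  then show ?thesis using \<pi> by (simp add: invariant_law_def space_prob_algebra)
qed

text \<open>
  An invariant law is, for every n, the mixture of the n-step laws from its own points; each of these
  tends to \<pi>, and dominated convergence carries this over to the mixture.
\<close>

lemma invariant_law_unique:
  assumes Q: "Q \<in> borel \<rightarrow>\<^sub>M prob_algebra borel" and \<pi>: "\<pi> \<in> borel_probs"
    and lim: "\<And>z. (\<lambda>n. tv_dist (kernel_iter (return borel z) Q n) \<pi>) \<longlonglongrightarrow> 0"
    and \<nu>: "invariant_law Q \<nu>"
  shows "\<nu> = \<pi>"
proof (rule tv_dist_eq_0_imp_eq)
  let ?P = "\<lambda>z. kernel_iter (return borel z) Q"
  have P: "?P z n \<in> borel_probs" for z n by (intro kernel_iter_probs return_borel_probs Q)
  show \<nu>': "\<nu> \<in> borel_probs" using \<nu> by (simp add: invariant_law_def space_prob_algebra)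
  show "\<pi> \<in> borel_probs" by fact
  interpret prob_space \<nu> using borel_probsD[OF \<nu>'] by simp
  have iter: "kernel_iter \<nu> Q n = \<nu>" for n
    using \<nu> by (induction n) (auto simp: kernel_iter_0 kernel_iter_Suc invariant_law_def)
  have "measure \<nu> A = measure \<pi> A" if A: "A \<in> sets borel" for A
  proof -
    have "measure \<nu> A = (\<integral>z. measure (?P z n) A \<partial>\<nu>)" for n
      using measure_bind_kernel[OF \<nu>' kernel_iter_measurable[OF Q] A, of n] kernel_iter_mixture[OF \<nu>' Q, of n] iter
      by simp
    moreover have "(\<lambda>n. \<integral>z. measure (?P z n) A \<partial>\<nu>) \<longlonglongrightarrow> (\<integral>z. measure \<pi> A \<partial>\<nu>)"
    proof (rule integral_dominated_convergence[where w = "\<lambda>_. 1"])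
      show "(\<lambda>z. measure (?P z n) A) \<in> borel_measurable \<nu>" for n
        using measurable_kernel_measure[OF kernel_iter_measurable[OF Q] A] by (simp add: borel_probsD(4)[OF \<nu>'])
      show "AE z in \<nu>. (\<lambda>n. measure (?P z n) A) \<longlonglongrightarrow> measure \<pi> A"
        by (intro AE_I2 tv_dist_tendsto_measure P \<pi> lim A)
      show "AE z in \<nu>. norm (measure (?P z n) A) \<le> 1" for n
        using prob_space.prob_le_1[OF borel_probsD(1)[OF P]] by simp
    qed auto
    ultimately have "(\<lambda>n. measure \<nu> A) \<longlonglongrightarrow> measure \<pi> A" by (simp add: prob_space[simplified])
    then show ?thesis by (simp add: LIMSEQ_const_iff)
  qed
  then show "tv_dist \<nu> \<pi> \<le> 0" by (intro tv_dist_least) simp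
qed

lemma tv_dist_tendsto_integral:
  fixes f :: "'a::topological_space \<Rightarrow> real"
  assumes \<mu>: "\<And>n. \<mu> n \<in> borel_probs" and \<pi>: "\<pi> \<in> borel_probs"
    and lim: "(\<lambda>n. tv_dist (\<mu> n) \<pi>) \<longlonglongrightarrow> 0"
    and f: "f \<in> borel_measurable borel" "\<And>x. \<bar>f x\<bar> \<le> 1"
  shows "(\<lambda>n. \<integral>x. f x \<partial>\<mu> n) \<longlonglongrightarrow> (\<integral>x. f x \<partial>\<pi>)"
proof -
  have "(\<lambda>n. 2 * tv_dist (\<mu> n) \<pi>) \<longlonglongrightarrow> 2 * 0" by (intro tendsto_intros lim)
  then have "(\<lambda>n. (\<integral>x. f x \<partial>\<mu> n) - (\<integral>x. f x \<partial>\<pi>)) \<longlonglongrightarrow> 0"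
    unfolding mult_zero_right
    by (rule Lim_null_comparison[rotated])
       (auto intro!: always_eventually signed_integral_diff_le_tv_dist[OF \<mu> \<pi> f])
  then show ?thesis using LIM_zero_iff by blast
qed

section \<open>Gaussianity, the lower bound and the exponential rate\<close>

text \<open>
  The variance of u \<bullet> x under W(n) increases with n and is bounded, so it has a limit q, and the
  cosine integrals pass to the limit. The scalar t is made explicit because a one-dimensional
  characteristic function is wanted for fixed u.
\<close>

lemma cos_transform_limit:
  fixes M :: "real^'n^'n" and G :: "real^'k^'n"
  assumes \<rho>: "spectral_radius M < 1" and \<pi>: "\<pi> \<in> borel_probs"
    and lim: "(\<lambda>n. tv_dist (kernel_iter (return borel 0) (ar_kernel M G) n) \<pi>) \<longlonglongrightarrow> 0"
  obtains q where "q \<ge> 0" "\<And>t \<theta>. (\<integral>x. cos (t * (u \<bullet> x) + \<theta>) \<partial>\<pi>) = exp (- (t\<^sup>2 * q) / 2) * cos \<theta>"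
proof -
  let ?W = "kernel_iter (return borel 0) (ar_kernel M G)"
  have W: "?W n \<in> borel_probs" for n by (intro kernel_iter_probs return_borel_probs ar_kernel_measurable)
  obtain B where B: "\<And>n u. ar_var M G n u \<le> B * (norm u)\<^sup>2" using ar_var_bounded[OF \<rho>] by blast
  have "incseq (\<lambda>n. ar_var M G n u)" by (rule incseq_SucI) (simp add: ar_var_def)
  then obtain q where q: "(\<lambda>n. ar_var M G n u) \<longlonglongrightarrow> q" using B incseq_convergent by blast
  have "q \<ge> 0" by (rule LIMSEQ_le_const[OF q]) (auto simp: ar_var_def sum_nonneg)
  moreover have "(\<integral>x. cos (t * (u \<bullet> x) + \<theta>) \<partial>\<pi>) = exp (- (t\<^sup>2 * q) / 2) * cos \<theta>" for t \<theta>
  proof -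
    have scale: "ar_var M G n (t *\<^sub>R u) = t\<^sup>2 * ar_var M G n u" for n
      by (simp add: ar_var_def matrix_vector_mult_scaleR power_mult_distrib sum_distrib_left)
    have "(\<integral>x. cos (t * (u \<bullet> x) + \<theta>) \<partial>?W n) = exp (- (t\<^sup>2 * ar_var M G n u) / 2) * cos \<theta>" for n
      using cos_transform_kernel_iter[where u = "t *\<^sub>R u" and \<theta> = \<theta> and M = M and G = G and n = n] by (simp add: scale)
    moreover have "(\<lambda>n. \<integral>x. cos (t * (u \<bullet> x) + \<theta>) \<partial>?W n) \<longlonglongrightarrow> (\<integral>x. cos (t * (u \<bullet> x) + \<theta>) \<partial>\<pi>)"
      by (intro tv_dist_tendsto_integral W \<pi> lim) auto
    moreover have "(\<lambda>n. exp (- (t\<^sup>2 * ar_var M G n u) / 2) * cos \<theta>) \<longlonglongrightarrow> exp (- (t\<^sup>2 * q) / 2) * cos \<theta>"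
      by (intro tendsto_intros q) auto
    ultimately show ?thesis using LIMSEQ_unique by simp
  qed
  ultimately show ?thesis using that by blast
qed

text \<open>
  The phases 0 and -pi/2 give the real and the imaginary part.
\<close>

lemma char_eq_cos_transform:
  assumes \<mu>: "\<mu> \<in> borel_probs" and f[measurable]: "f \<in> borel_measurable borel"
    and cos: "\<And>t \<theta>. (\<integral>x. cos (t * f x + \<theta>) \<partial>\<mu>) = \<phi> t * cos \<theta>"
  shows "char (distr \<mu> borel f) t = complex_of_real (\<phi> t)"
proof -
  interpret prob_space \<mu> using borel_probsD[OF \<mu>] by simp
  have [measurable]: "f \<in> borel_measurable \<mu>" using f by (simp add: borel_probsD(4)[OF \<mu>])
  have re_im: "Re (iexp s) = cos s" "Im (iexp s) = sin s" for s
    by (simp_all flip: cis_conv_exp)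
  have "char (distr \<mu> borel f) t = (CLINT x|\<mu>. iexp (t * f x))"
    unfolding char_def by (subst integral_distr) auto
  moreover have int: "integrable \<mu> (\<lambda>x. iexp (t * f x))"
    by (rule integrable_const_bound[where B=1]) auto
  moreover have "Re (CLINT x|\<mu>. iexp (t * f x)) = \<phi> t"
    using cos[of t 0] by (subst integral_Re[OF int, symmetric]) (simp only: re_im, simp)
  moreover have "Im (CLINT x|\<mu>. iexp (t * f x)) = 0"
    using cos[of t "- (pi / 2)"]
    by (subst integral_Im[OF int, symmetric]) (simp only: re_im, simp add: cos_diff)
  ultimately show ?thesis by (simp add: complex_eq_iff)
qed

lemma char_normal:
  assumes s: "s > 0"
  shows "char (density lborel (\<lambda>x. ennreal (normal_density 0 s x))) t = of_real (exp (- (t\<^sup>2 * s\<^sup>2) / 2))"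
proof -
  interpret N: prob_space std_normal_distribution by (rule prob_space_normal_density) simp
  have "distributed std_normal_distribution lborel (\<lambda>x. x) std_normal_density"
    by (auto simp: distributed_def distr_id2)
  then have "distributed std_normal_distribution lborel (\<lambda>x. 0 + s * x) (normal_density (0 + s * 0) (\<bar>s\<bar> * 1))"
    using s by (intro N.normal_density_affine) auto
  then have "distr std_normal_distribution lborel (\<lambda>x. s * x) = density lborel (\<lambda>x. ennreal (normal_density 0 s x))"
    using s by (simp add: distributed_distr_eq_density)
  then have "char (density lborel (\<lambda>x. ennreal (normal_density 0 s x))) t
      = (CLINT x|distr std_normal_distribution lborel (\<lambda>x. s * x). iexp (t * x))"
    by (simp add: char_def)
  also have "\<dots> = char std_normal_distribution (t * s)"
    unfolding char_def by (subst integral_distr) (auto simp: mult_ac)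
  finally show ?thesis by (simp add: char_std_normal_distribution power_mult_distrib)
qed

text \<open>
  One-dimensional laws are determined by their characteristic functions. The value q = 0 has to
  be split off since the Dirac mass has no density.
\<close>

lemma centered_gaussianI:
  fixes \<pi> :: "(real^'n) measure"
  assumes \<pi>: "\<pi> \<in> borel_probs"
    and q: "\<And>u. \<exists>q\<ge>0. \<forall>t \<theta>. (\<integral>x. cos (t * (u \<bullet> x) + \<theta>) \<partial>\<pi>) = exp (- (t\<^sup>2 * q) / 2) * cos \<theta>"
  shows "centered_gaussian \<pi>"
  unfolding centered_gaussian_def
proof (intro conjI allI)
  show "prob_space \<pi>" "sets \<pi> = sets borel" using borel_probsD[OF \<pi>] by auto
  fix u :: "real^'n"
  let ?D = "distr \<pi> borel (\<lambda>x. u \<bullet> x)"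
  obtain q where q: "q \<ge> 0" "\<And>t \<theta>. (\<integral>x. cos (t * (u \<bullet> x) + \<theta>) \<partial>\<pi>) = exp (- (t\<^sup>2 * q) / 2) * cos \<theta>"
    using q by blast
  have D: "real_distribution ?D"
    using borel_probsD[OF borel_probs_distr[OF \<pi>, of "\<lambda>x. u \<bullet> x"]]
    by (simp add: real_distribution_def real_distribution_axioms_def)
  have char: "char ?D t = of_real (exp (- (t\<^sup>2 * q) / 2))" for t
    by (rule char_eq_cos_transform[OF \<pi> _ q(2)]) simp
  show "?D = return borel 0 \<or> (\<exists>s>0. ?D = density lborel (\<lambda>t. ennreal (normal_density 0 s t)))"
  proof (cases "q = 0")
    case True
    have "char (return borel 0) t = char ?D t" for t
      unfolding char using True by (simp add: char_def integral_return)
    then have "?D = return borel 0"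
      by (intro Levy_uniqueness D)
         (auto simp: real_distribution_def real_distribution_axioms_def prob_space_return)
    then show ?thesis ..
  next
    case False
    with q(1) have s: "sqrt q > 0" by simp
    have "?D = density lborel (\<lambda>t. ennreal (normal_density 0 (sqrt q) t))"
      using s q(1) prob_space_normal_density[OF s, of 0]
      by (intro Levy_uniqueness D)
         (auto simp: real_distribution_def real_distribution_axioms_def char char_normal)
    then show ?thesis using s by blast
  qed
qed

lemma sin_ge_half:
  fixes x :: real
  assumes "0 \<le> x" "x \<le> 1"
  shows "x / 2 \<le> sin x"
proof -
  have "sin 0 - 0 / 2 \<le> sin x - x / 2"
  proof (rule DERIV_nonneg_imp_nondecreasing[OF assms(1)])
    fix y assume y: "0 \<le> y" "y \<le> x"
    have "cos (pi / 3) \<le> cos y" using y assms pi_gt3 by (intro cos_monotone_0_pi_le) auto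
    then show "\<exists>d. ((\<lambda>x. sin x - x / 2) has_real_derivative d) (at y) \<and> 0 \<le> d"
      by (intro exI[of _ "cos y - 1 / 2"] conjI) (auto intro!: derivative_eq_intros simp: cos_60)
  qed
  then show ?thesis by simp
qed

text \<open>
  The test function is sin(u \<bullet> x) for the unit vector u in the direction of M^n z. Its mean
  under the law from z is exp(-q/2) sin |M^n z|, where q is bounded uniformly in n, and the
  sine is at least half its argument on [0, 1].
\<close>

lemma tv_dist_lower_bound:
  fixes M :: "real^'n^'n" and G :: "real^'k^'n"
  assumes \<rho>: "spectral_radius M < 1"
  obtains c where "c > 0" "\<And>z n \<kappa>. \<kappa> \<in> borel_probs \<Longrightarrow> (\<And>u. (\<integral>x. sin (u \<bullet> x) \<partial>\<kappa>) = 0)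
      \<Longrightarrow> norm (matpow M n *v z) \<le> 1
      \<Longrightarrow> c * norm (matpow M n *v z) \<le> tv_dist (kernel_iter (return borel z) (ar_kernel M G) n) \<kappa>"
proof -
  obtain B where B: "\<And>n u. ar_var M G n u \<le> B * (norm u)\<^sup>2" using ar_var_bounded[OF \<rho>] by blast
  define c where "c = exp (- B / 2) / 4"
  have "c * norm (matpow M n *v z) \<le> tv_dist (kernel_iter (return borel z) (ar_kernel M G) n) \<kappa>"
    if \<kappa>: "\<kappa> \<in> borel_probs" "\<And>u. (\<integral>x. sin (u \<bullet> x) \<partial>\<kappa>) = 0" and small: "norm (matpow M n *v z) \<le> 1"
    for z n \<kappa>
  proof (cases "matpow M n *v z = 0")
    case True
    then show ?thesis
      using tv_dist_nonneg[OF kernel_iter_probs[OF return_borel_probs ar_kernel_measurable] \<kappa>(1)] by simp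
  next
    case False
    let ?P = "\<lambda>z. kernel_iter (return borel z) (ar_kernel M G) n"
    have P: "?P z \<in> borel_probs" for z by (intro kernel_iter_probs return_borel_probs ar_kernel_measurable)
    define m where "m = matpow M n *v z"
    define u where "u = m /\<^sub>R norm m"
    have m0: "m \<noteq> 0" using False by (simp add: m_def)
    have um: "u \<bullet> m = norm m" "norm u = 1"
      using m0 by (auto simp: u_def power2_eq_square simp flip: power2_norm_eq_inner)
    have "(\<integral>x. sin (u \<bullet> x) \<partial>?P z) = (\<integral>x. cos (u \<bullet> x + (norm m - pi / 2)) \<partial>?P 0)"
    proof -
      have *: "sin (u \<bullet> (m + x)) = cos (u \<bullet> x + (norm m - pi / 2))" for x
      proof -
        have "cos (s - pi / 2) = sin s" for s :: real by (simp add: cos_diff)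
        from this[of "u \<bullet> x + norm m"] show ?thesis by (simp add: inner_add_right um algebra_simps)
      qed
      show ?thesis
        unfolding kernel_iter_return_shift[of z M G n 0] diff_zero m_def[symmetric]
        by (subst integral_distr) (auto simp: * borel_probsD(4)[OF P])
    qed
    also have "\<dots> = exp (- ar_var M G n u / 2) * sin (norm m)"
      by (subst cos_transform_kernel_iter) (simp add: cos_diff)
    finally have I: "(\<integral>x. sin (u \<bullet> x) \<partial>?P z) = exp (- ar_var M G n u / 2) * sin (norm m)" .
    have "exp (- B / 2) * (norm m / 2) \<le> exp (- ar_var M G n u / 2) * sin (norm m)"
      using B[of n u] small um(2) by (intro mult_mono sin_ge_half) (auto simp: m_def)
    also have "\<dots> \<le> 2 * tv_dist (?P z) \<kappa>"
      using signed_integral_diff_le_tv_dist[OF P \<kappa>(1), of "\<lambda>x. sin (u \<bullet> x)" z] \<kappa>(2)[of u] by (simp add: I)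
    finally show ?thesis by (simp add: c_def m_def)
  qed
  then show ?thesis using that[of c] by (simp add: c_def)
qed

lemma integral_sin_eq_0:
  assumes "\<And>\<theta>. (\<integral>x. cos (u \<bullet> x + \<theta>) \<partial>\<kappa>) = q * cos \<theta>"
  shows "(\<integral>x. sin (u \<bullet> x) \<partial>\<kappa>) = 0"
  using assms[of "- pi / 2"] by (simp add: cos_diff)

text \<open>
  Any constant C disappears under the n-th root; C + 1 is used because the n-th root of a positive
  constant tends to 1.
\<close>

lemma eventually_root_less:
  fixes a :: "nat \<Rightarrow> real"
  assumes bound: "\<And>r. \<rho> < r \<Longrightarrow> r < 1 \<Longrightarrow> \<exists>C\<ge>0. \<forall>n\<ge>n0. a n \<le> C * r ^ n"
    and \<rho>: "0 \<le> \<rho>" "\<rho> < 1" and x: "\<rho> < x"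
  shows "eventually (\<lambda>n. root n (a n) < x) sequentially"
proof -
  obtain r where r: "\<rho> < r" "r < min x 1" using dense[of \<rho> "min x 1"] \<rho> x by auto
  obtain C where C: "C \<ge> 0" "\<And>n. n \<ge> n0 \<Longrightarrow> a n \<le> C * r ^ n" using bound[of r] r by auto
  have "(\<lambda>n. root n (C + 1) * r) \<longlonglongrightarrow> 1 * r"
    using C(1) by (intro tendsto_intros LIMSEQ_root_const) auto
  then have "eventually (\<lambda>n. root n (C + 1) * r < x) sequentially"
    using r by (intro order_tendstoD(2)) auto
  moreover have "eventually (\<lambda>n. n \<ge> max n0 1) sequentially" by (rule eventually_ge_at_top)
  ultimately show ?thesis
  proof eventually_elim
    case (elim n)
    have "a n \<le> (C + 1) * r ^ n"
      using C(2)[of n] elim r \<rho> by (intro order.trans[OF C(2)] mult_right_mono) auto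
    then have "root n (a n) \<le> root n ((C + 1) * r ^ n)" using elim by simp
    also have "\<dots> = root n (C + 1) * r" using elim r \<rho> by (simp add: real_root_mult real_root_power_cancel)
    finally show ?case using elim by simp
  qed
qed

lemma limsup_root_le:
  fixes a :: "nat \<Rightarrow> real"
  assumes "\<And>r. \<rho> < r \<Longrightarrow> r < 1 \<Longrightarrow> \<exists>C\<ge>0. \<forall>n\<ge>n0. a n \<le> C * r ^ n"
    and "0 \<le> \<rho>" "\<rho> < 1"
  shows "limsup (\<lambda>n. ereal (root n (a n))) \<le> ereal \<rho>"
  unfolding Limsup_le_iff
proof (intro allI impI)
  fix y assume "ereal \<rho> < y"
  then obtain x where x: "\<rho> < x" "ereal x < y" using ereal_dense2[of "ereal \<rho>" y] by auto
  show "eventually (\<lambda>n. ereal (root n (a n)) < y) sequentially"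
  proof (rule eventually_mono)
    show "eventually (\<lambda>n. root n (a n) < x) sequentially" by (rule eventually_root_less[OF _ assms(2,3) x(1)]) (rule assms(1))
  qed (use x(2) in \<open>auto intro: less_trans[of _ "ereal x"]\<close>)
qed

text \<open>
  The lower bound involves \<rho> itself and the upper bound only rates above \<rho>; both
  constants are harmless under the n-th root.
\<close>

lemma root_tendsto:
  fixes a :: "nat \<Rightarrow> real"
  assumes upper: "\<And>r. \<rho> < r \<Longrightarrow> r < 1 \<Longrightarrow> \<exists>C\<ge>0. \<forall>n\<ge>n0. a n \<le> C * r ^ n"
    and \<rho>: "0 \<le> \<rho>" "\<rho> < 1"
    and lower: "c > 0" "eventually (\<lambda>n. c * \<rho> ^ n \<le> a n) sequentially"
  shows "(\<lambda>n. root n (a n)) \<longlonglongrightarrow> \<rho>"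
proof (rule order_tendstoI)
  fix x assume "x < \<rho>"
  have "(\<lambda>n. root n c * \<rho>) \<longlonglongrightarrow> 1 * \<rho>" by (intro tendsto_intros LIMSEQ_root_const lower)
  then have "eventually (\<lambda>n. x < root n c * \<rho>) sequentially"
    using \<open>x < \<rho>\<close> by (intro order_tendstoD(1)) auto
  moreover have "eventually (\<lambda>n. n \<ge> 1) sequentially" by (rule eventually_ge_at_top)
  ultimately show "eventually (\<lambda>n. x < root n (a n)) sequentially" using lower(2)
  proof eventually_elim
    case (elim n)
    have "root n c * \<rho> = root n (c * \<rho> ^ n)" using elim \<rho> by (simp add: real_root_mult real_root_power_cancel)
    also have "\<dots> \<le> root n (a n)" using elim by simp
    finally show ?case using elim by simp
  qed
next
  fix x assume "\<rho> < x"
  then show "eventually (\<lambda>n. root n (a n) < x) sequentially"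
    by (intro eventually_root_less[OF upper \<rho>])
qed

text \<open>
  The one-step covariance is G G^T, and a positive definite matrix has trivial kernel.
\<close>

lemma ar_cov_1_invertible:
  fixes M :: "real^'n^'n" and G :: "real^'k^'n"
  assumes "\<And>u. u \<noteq> 0 \<Longrightarrow> u \<bullet> ((G ** transpose G) *v u) > 0"
  shows "invertible (ar_cov M G 1)"
proof -
  have "ar_cov M G 1 = G ** transpose G" by (simp add: ar_cov_def matpow_0)
  moreover have "u = 0" if "(G ** transpose G) *v u = 0" for u using assms[of u] that by auto
  ultimately show ?thesis
    by (simp add: invertible_left_inverse matrix_left_invertible_ker)
qed

theorem lemma4p1:
  fixes M :: "real^'n^'n" and G :: "real^'k^'n"
  defines "Q \<equiv> ar_kernel M G"
  assumes "spectral_radius M < 1"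
  shows "((\<exists>n0\<ge>1. invertible (ar_cov M G n0)) \<longrightarrow>
       (\<exists>\<pi>. invariant_law Q \<pi> \<and> (\<forall>\<pi>'. invariant_law Q \<pi>' \<longrightarrow> \<pi>' = \<pi>) \<and>
         centered_gaussian \<pi> \<and>
         (\<forall>z. limsup (\<lambda>n. ereal (root n (tv_dist (kernel_iter (return borel z) Q n) \<pi>)))
                \<le> ereal (spectral_radius M)) \<and>
         (\<exists>z. (\<lambda>n. root n (tv_dist (kernel_iter (return borel z) Q n) \<pi>))
                \<longlonglongrightarrow> spectral_radius M) \<and>
         (\<exists>z z'. (\<lambda>n. root n (tv_dist (kernel_iter (return borel z) Q n)
                                       (kernel_iter (return borel z') Q n)))
                \<longlonglongrightarrow> spectral_radius M)))
     \<and> ((\<forall>u. u \<noteq> 0 \<longrightarrow> u \<bullet> ((G ** transpose G) *v u) > 0) \<longrightarrow> invertible (ar_cov M G 1))"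
proof (intro conjI impI)
  assume "\<forall>u. u \<noteq> 0 \<longrightarrow> u \<bullet> ((G ** transpose G) *v u) > 0"
  then show "invertible (ar_cov M G 1)" by (intro ar_cov_1_invertible) blast
next
  assume "\<exists>n0\<ge>1. invertible (ar_cov M G n0)"
  then obtain n0 where inv: "invertible (ar_cov M G n0)" by blast
  let ?\<rho> = "spectral_radius M"
  let ?P = "\<lambda>z. kernel_iter (return borel z) Q"
  note \<rho> = spectral_radius_nonneg[of M] \<open>?\<rho> < 1\<close>
  have Q: "Q \<in> borel \<rightarrow>\<^sub>M prob_algebra borel" unfolding Q_def by (rule ar_kernel_measurable)
  have P: "?P z n \<in> borel_probs" for z n by (intro kernel_iter_probs return_borel_probs Q)
  obtain \<pi> where \<pi>: "\<pi> \<in> borel_probs"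
    and to_\<pi>: "\<And>r z. ?\<rho> < r \<Longrightarrow> r < 1 \<Longrightarrow> \<exists>C\<ge>0. \<forall>n\<ge>n0. tv_dist (?P z n) \<pi> \<le> C * r ^ n"
    unfolding Q_def using geometric_convergence_to_limit_law[OF inv \<rho>(2)] by metis
  have to_start: "\<exists>C\<ge>0. \<forall>n\<ge>n0. tv_dist (?P z n) (?P y n) \<le> C * r ^ n" if "?\<rho> < r" for r z y
    unfolding Q_def by (rule tv_dist_starting_points_geometric[OF inv that])
  obtain r where r: "?\<rho> < r" "r < 1" using dense[OF \<rho>(2)] by blast
  have r0: "0 \<le> r" using r \<rho> by linarith
  have lim: "(\<lambda>n. tv_dist (?P z n) \<pi>) \<longlonglongrightarrow> 0" for z
    using to_\<pi>[OF r, of z] tv_dist_nonneg[OF P \<pi>] r0 r(2) tendsto_zero_of_geometric_bound by metis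
  have cos_\<pi>: "\<exists>q\<ge>0. \<forall>t \<theta>. (\<integral>x. cos (t * (u \<bullet> x) + \<theta>) \<partial>\<pi>) = exp (- (t\<^sup>2 * q) / 2) * cos \<theta>" for u
    using cos_transform_limit[OF \<rho>(2) \<pi> lim[of 0, unfolded Q_def]] by metis
  have sin_\<pi>: "(\<integral>x. sin (u \<bullet> x) \<partial>\<pi>) = 0" for u
  proof -
    obtain q where "\<And>t \<theta>. (\<integral>x. cos (t * (u \<bullet> x) + \<theta>) \<partial>\<pi>) = exp (- (t\<^sup>2 * q) / 2) * cos \<theta>"
      using cos_\<pi> by blast
    from this[of 1] show ?thesis by (intro integral_sin_eq_0[where q = "exp (- q / 2)"]) simp
  qed
  have sin_0: "(\<integral>x. sin (u \<bullet> x) \<partial>?P 0 n) = 0" for u n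
    unfolding Q_def by (rule integral_sin_eq_0[OF cos_transform_kernel_iter])
  obtain z k where zk: "k > 0" "\<And>n. k * ?\<rho> ^ n \<le> norm (matpow M n *v z)"
    by (rule spectral_radius_growth_attained[of M]) blast
  obtain c where c: "c > 0" "\<And>z n \<kappa>. \<kappa> \<in> borel_probs \<Longrightarrow> (\<And>u. (\<integral>x. sin (u \<bullet> x) \<partial>\<kappa>) = 0)
      \<Longrightarrow> norm (matpow M n *v z) \<le> 1 \<Longrightarrow> c * norm (matpow M n *v z) \<le> tv_dist (?P z n) \<kappa>"
    unfolding Q_def by (rule tv_dist_lower_bound[OF \<rho>(2), of G]) blast
  obtain C where C: "\<And>n. norm (matpow M n *v z) \<le> C * r ^ n" using matpow_vector_growth[OF r(1)] by blast
  have "(\<lambda>n. norm (matpow M n *v z)) \<longlonglongrightarrow> 0"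
    by (rule tendsto_zero_of_geometric_bound[where C = C and r = r and ?n0.0 = 0]) (use C r0 r(2) in auto)
  then have small: "eventually (\<lambda>n. norm (matpow M n *v z) < 1) sequentially"
    by (rule order_tendstoD) simp
  have lower: "eventually (\<lambda>n. c * k * ?\<rho> ^ n \<le> tv_dist (?P z n) (\<kappa> n)) sequentially"
    if "\<And>n. \<kappa> n \<in> borel_probs" "\<And>u n. (\<integral>x. sin (u \<bullet> x) \<partial>\<kappa> n) = 0" for \<kappa>
    using small
  proof eventually_elim
    case (elim n)
    have "c * k * ?\<rho> ^ n \<le> c * norm (matpow M n *v z)" using zk(2)[of n] c(1) by simp
    also have "\<dots> \<le> tv_dist (?P z n) (\<kappa> n)" using elim that by (intro c(2)) auto
    finally show ?case .
  qed
  have ck: "c * k > 0" using c(1) zk(1) by simp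
  show "\<exists>\<pi>. invariant_law Q \<pi> \<and> (\<forall>\<pi>'. invariant_law Q \<pi>' \<longrightarrow> \<pi>' = \<pi>) \<and>
         centered_gaussian \<pi> \<and>
         (\<forall>z. limsup (\<lambda>n. ereal (root n (tv_dist (kernel_iter (return borel z) Q n) \<pi>)))
                \<le> ereal (spectral_radius M)) \<and>
         (\<exists>z. (\<lambda>n. root n (tv_dist (kernel_iter (return borel z) Q n) \<pi>))
                \<longlonglongrightarrow> spectral_radius M) \<and>
         (\<exists>z z'. (\<lambda>n. root n (tv_dist (kernel_iter (return borel z) Q n)
                                       (kernel_iter (return borel z') Q n)))
                \<longlonglongrightarrow> spectral_radius M)"
  proof (intro exI[of _ \<pi>] conjI allI impI)
    show "invariant_law Q \<pi>" by (rule limit_law_invariant[OF Q \<pi> lim])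
    show "\<pi>' = \<pi>" if "invariant_law Q \<pi>'" for \<pi>' by (rule invariant_law_unique[OF Q \<pi> lim that])
    show "centered_gaussian \<pi>" by (rule centered_gaussianI[OF \<pi> cos_\<pi>])
    show "limsup (\<lambda>n. ereal (root n (tv_dist (?P y n) \<pi>))) \<le> ereal ?\<rho>" for y
      by (rule limsup_root_le[OF _ \<rho>]) (rule to_\<pi>)
    show "\<exists>z. (\<lambda>n. root n (tv_dist (?P z n) \<pi>)) \<longlonglongrightarrow> ?\<rho>"
      by (intro exI[of _ z] root_tendsto[where ?n0.0 = n0, OF _ \<rho> ck] to_\<pi> lower \<pi> sin_\<pi>)
    show "\<exists>z z'. (\<lambda>n. root n (tv_dist (?P z n) (?P z' n))) \<longlonglongrightarrow> ?\<rho>"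
      (* The second initial state is the origin, whose law is symmetric. *)
      by (intro exI[of _ z] exI[of _ 0] root_tendsto[where ?n0.0 = n0, OF _ \<rho> ck] to_start lower P sin_0)
  qed
qed

end
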